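(* For every $d\ge2$ and $H\le\Sigma_d$, the commutator subgroup $[V_d'(H),V_d'(H)]$ is simple.
   Context: $A=\{a_1,\dots,a_d\}$, $A^\omega$ the infinite words with ultrametric $d(x,y)=e^{1-n}$ ($n$ the first index where $x,y$ differ); balls are the sets $wA^\omega$, $w$ a finite word. $\Sigma_d$ is the symmetric group on $A$ acting letterwise on $A^\omega$, $A_d$ its alternating subgroup. $V_d(H)$ is the group of homeomorphisms $g$ of $A^\omega$ such that every point lies in a ball $w_1A^\omega$ on which $g$ has the form $w_1y\mapsto w_2\sigma(y)$ for some finite word $w_2$ and $\sigma\in H$. Every $g\in V_d(H)$ admits a *table*: finite words $v_1<\dots<v_m$ and $u_1<\dots<u_m$ (lexicographic order) such that $\{v_iA^\omega\}$ and $\{u_iA^\omega\}$ are partitions of $A^\omega$, elements $h_i\in H$ and $\tau\in\Sigma_m$ with $g(v_iy)=u_{\tau(i)}h_i(y)$; the table is *even/odd* according to the parity of $\tau$. If $d$ is odd and $H\le A_d$, the parity does not depend on the table and $V_d'(H)$ is the index-2 subgroup of elements with even tables; otherwise $V_d'(H)=V_d(H)$. *)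

theory Defs
  imports "HOL-Algebra.Algebra" "HOL-Combinatorics.Permutations" Complex_Main
begin

text \<open>Alphabet A = {1..d} (letters a_1 < ... < a_d), infinite words are functions
  nat \<Rightarrow> nat (0-based positions) with values in {1..d}; finite words are lists.\<close>

definition iwords :: "nat \<Rightarrow> (nat \<Rightarrow> nat) set" where
  "iwords d = {x. \<forall>i. x i \<in> {1..d}}"

definition fwords :: "nat \<Rightarrow> nat list set" where
  "fwords d = {w. set w \<subseteq> {1..d}}"

definition conc :: "nat list \<Rightarrow> (nat \<Rightarrow> nat) \<Rightarrow> (nat \<Rightarrow> nat)" where
  "conc w y = (\<lambda>i. if i < length w then w ! i else y (i - length w))"

definition cyl :: "nat \<Rightarrow> nat list \<Rightarrow> (nat \<Rightarrow> nat) set" where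
  "cyl d w = {x \<in> iwords d. \<forall>i < length w. x i = w ! i}"

text \<open>Ultrametric d(x,y) = e^(1-n), n the first (1-based) index where x, y differ.\<close>
definition wdist :: "(nat \<Rightarrow> nat) \<Rightarrow> (nat \<Rightarrow> nat) \<Rightarrow> real" where
  "wdist x y = (if x = y then 0 else exp (1 - real (Suc (LEAST i. x i \<noteq> y i))))"

definition wcont :: "nat \<Rightarrow> ((nat \<Rightarrow> nat) \<Rightarrow> (nat \<Rightarrow> nat)) \<Rightarrow> bool" where
  "wcont d g \<longleftrightarrow> (\<forall>x \<in> iwords d. \<forall>e > 0. \<exists>\<delta> > 0. \<forall>y \<in> iwords d.
       wdist y x < \<delta> \<longrightarrow> wdist (g y) (g x) < e)"

text \<open>Homeomorphisms of A^omega, represented extensionally (identity off A^omega).\<close>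
definition whomeo :: "nat \<Rightarrow> ((nat \<Rightarrow> nat) \<Rightarrow> (nat \<Rightarrow> nat)) \<Rightarrow> bool" where
  "whomeo d g \<longleftrightarrow> bij_betw g (iwords d) (iwords d) \<and> (\<forall>x. x \<notin> iwords d \<longrightarrow> g x = x)
     \<and> wcont d g \<and> wcont d (inv_into (iwords d) g)"

text \<open>V_d(H); H is a set of permutations of {1..d} acting letterwise (y \<mapsto> \<sigma> \<circ> y).\<close>
definition Vd :: "nat \<Rightarrow> (nat \<Rightarrow> nat) set \<Rightarrow> ((nat \<Rightarrow> nat) \<Rightarrow> (nat \<Rightarrow> nat)) set" where
  "Vd d H = {g. whomeo d g \<and>
     (\<forall>x \<in> iwords d. \<exists>w1 \<in> fwords d. \<exists>w2 \<in> fwords d. \<exists>\<sigma> \<in> H.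
        x \<in> cyl d w1 \<and> (\<forall>y \<in> iwords d. g (conc w1 y) = conc w2 (\<sigma> \<circ> y)))}"

definition lexless :: "nat list \<Rightarrow> nat list \<Rightarrow> bool" where
  "lexless u v \<longleftrightarrow> (u, v) \<in> lexord {(a, b). a < b}"

definition is_partition :: "nat \<Rightarrow> nat list list \<Rightarrow> bool" where
  "is_partition d ws \<longleftrightarrow> set ws \<subseteq> fwords d \<and>
     (\<forall>i < length ws. \<forall>j < length ws. i \<noteq> j \<longrightarrow> cyl d (ws ! i) \<inter> cyl d (ws ! j) = {}) \<and>
     (\<Union>i < length ws. cyl d (ws ! i)) = iwords d"

definition is_table :: "nat \<Rightarrow> (nat \<Rightarrow> nat) set \<Rightarrow> ((nat \<Rightarrow> nat) \<Rightarrow> (nat \<Rightarrow> nat))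
     \<Rightarrow> nat list list \<Rightarrow> nat list list \<Rightarrow> (nat \<Rightarrow> (nat \<Rightarrow> nat)) \<Rightarrow> (nat \<Rightarrow> nat) \<Rightarrow> bool" where
  "is_table d H g vs us hs \<tau> \<longleftrightarrow> length vs = length us \<and>
     sorted_wrt lexless vs \<and> sorted_wrt lexless us \<and>
     is_partition d vs \<and> is_partition d us \<and>
     (\<forall>i < length vs. hs i \<in> H) \<and> \<tau> permutes {..<length vs} \<and>
     (\<forall>i < length vs. \<forall>y \<in> iwords d. g (conc (vs ! i) y) = conc (us ! \<tau> i) (hs i \<circ> y))"

definition Vd' :: "nat \<Rightarrow> (nat \<Rightarrow> nat) set \<Rightarrow> ((nat \<Rightarrow> nat) \<Rightarrow> (nat \<Rightarrow> nat)) set" where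
  "Vd' d H = (if odd d \<and> H \<subseteq> carrier (alt_group d)
      then {g \<in> Vd d H. \<exists>vs us hs \<tau>. is_table d H g vs us hs \<tau> \<and> evenperm \<tau>}
      else Vd d H)"

definition Vgrp' :: "nat \<Rightarrow> (nat \<Rightarrow> nat) set \<Rightarrow> ((nat \<Rightarrow> nat) \<Rightarrow> (nat \<Rightarrow> nat)) monoid" where
  "Vgrp' d H = \<lparr>carrier = Vd' d H, monoid.mult = (\<circ>), one = id\<rparr>"

definition simple_grp :: "('a, 'b) monoid_scheme \<Rightarrow> bool" where
  "simple_grp G \<longleftrightarrow> group G \<and> carrier G \<noteq> {\<one>\<^bsub>G\<^esub>} \<and>
     (\<forall>N. N \<lhd> G \<longrightarrow> N = {\<one>\<^bsub>G\<^esub>} \<or> N = carrier G)"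

end

theory Submission
  imports Defs "HOL-Library.List_Lexorder"
begin

text \<open>
  Write \<open>V = V_d(H)\<close>, \<open>G = V_d'(H)\<close> and \<open>D = [G, G]\<close>. The simplicity argument only uses
  \<open>[V, V] \<le> G \<le> V\<close>: \<open>V\<close> contains maps squeezing the complement of one ball into another
  ball while fixing some ball pointwise, and commutators of such maps are again of this kind, so
  \<open>[V, V]\<close> and \<open>D\<close> contain them as well. If \<open>N\<close> is a nontrivial normal subgroup of \<open>D\<close>,
  some \<open>n \<in> N\<close> moves a ball off itself; double commutators with \<open>n\<close> show that \<open>N\<close>
  contains \<open>[a, b]\<close> for \<open>a, b \<in> G\<close> supported in a small ball, hence, after squeezing, for all
  \<open>a, b \<in> G\<close> fixing a common ball. Elements fixing a ball generate \<open>G\<close> and commute modulo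
  these commutators, so \<open>D \<le> N\<close>.

  For \<open>[V, V] \<le> G\<close> when \<open>d\<close> is odd and \<open>H \<le> A_d\<close>, the parity of a table is read off as
  the number of pairs of partition pieces whose lexicographic order \<open>g\<close> reverses. Splitting the
  pieces into blocks of odd size, on each of which a letterwise even permutation acts, does not
  change it modulo 2; hence it is a homomorphism on \<open>V\<close>.
\<close>

unbundle no m_inv_syntax

section \<open>Groups of bijections squeezing balls\<close>

text \<open>The obstacle in the simplicity part is that \<open>N\<close> is normal in
  \<open>D\<close> only, whereas commutator identities and the fixed balls of arbitrary elements
  bring in conjugation by all of \<open>G\<close>. Two devices remove it. A squeezing map fixes a
  ball into which an inverse copy of itself can be placed, so squeezing maps are available among
  commutators and hence inside \<open>D\<close>. And \<open>N\<close> is replaced by its largest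
  part invariant under \<open>G\<close>, called \<open>core\<close>.

  All maps are bijections of a whole type that are the identity off the space in question, so that
  groups are plain sets of functions with composition and \<open>inv\<close>.

  In the parity part, closure of the even elements under composition is not evident from tables,
  since two tables need not share a partition. Order reversals are therefore counted on finite
  samples of words with constant tail: a cylinder of a word of length at most the depth of the
  sample contains a power of \<open>d\<close>, hence an odd number, of sample points.\<close>

definition perm_group :: "('a \<Rightarrow> 'a) set \<Rightarrow> bool" where
  "perm_group S \<longleftrightarrow> id \<in> S \<and> (\<forall>f\<in>S. bij f \<and> inv f \<in> S \<and> (\<forall>g\<in>S. f \<circ> g \<in> S))"

definition comm :: "('a \<Rightarrow> 'a) \<Rightarrow> ('a \<Rightarrow> 'a) \<Rightarrow> 'a \<Rightarrow> 'a" where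
  "comm f g = f \<circ> g \<circ> inv f \<circ> inv g"

definition comms :: "('a \<Rightarrow> 'a) set \<Rightarrow> ('a \<Rightarrow> 'a) set" where
  "comms S = {comm f g |f g. f \<in> S \<and> g \<in> S}"

definition supp_in :: "('a \<Rightarrow> 'a) \<Rightarrow> 'a set \<Rightarrow> bool" where
  "supp_in g U \<longleftrightarrow> (\<forall>x. x \<notin> U \<longrightarrow> g x = x)"

section \<open>Supports and commutators of bijections\<close>

lemma perm_groupD:
  assumes "perm_group S"
  shows "id \<in> S" "f \<in> S \<Longrightarrow> bij f" "f \<in> S \<Longrightarrow> inv f \<in> S" "f \<in> S \<Longrightarrow> g \<in> S \<Longrightarrow> f \<circ> g \<in> S"
  using assms by (auto simp: perm_group_def)

declare bij_imp_bij_inv [simp]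

lemma bij_inv_simps [simp]:
  assumes "bij f"
  shows "inv f (f x) = x" "f (inv f y) = y" "inv (inv f) = f"
  using assms by (simp_all add: bij_is_inj bij_is_surj surj_f_inv_f inv_inv_eq)

lemma inv_o_apply [simp]: "bij f \<Longrightarrow> bij g \<Longrightarrow> inv (f \<circ> g) x = inv g (inv f x)"
  by (simp add: o_inv_distrib)

lemma bij_o [simp]: "bij f \<Longrightarrow> bij g \<Longrightarrow> bij (f \<circ> g)"
  by (rule bij_comp)

lemma comm_apply: "comm f g x = f (g (inv f (inv g x)))"
  by (simp add: comm_def)

lemma bij_comm [simp]: "bij f \<Longrightarrow> bij g \<Longrightarrow> bij (comm f g)"
  by (simp add: comm_def)

lemma comm_in: "perm_group S \<Longrightarrow> f \<in> S \<Longrightarrow> g \<in> S \<Longrightarrow> comm f g \<in> S"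
  by (simp add: comm_def perm_groupD)

lemma inv_comm: "bij f \<Longrightarrow> bij g \<Longrightarrow> inv (comm f g) = comm g f"
  by (simp add: comm_def fun_eq_iff)

lemma supp_in_mono: "supp_in g U \<Longrightarrow> U \<subseteq> W \<Longrightarrow> supp_in g W"
  by (auto simp: supp_in_def)

lemma supp_in_comp: "supp_in f U \<Longrightarrow> supp_in g U \<Longrightarrow> supp_in (f \<circ> g) U"
  by (auto simp: supp_in_def)

lemma supp_in_comp_mono:
  assumes "supp_in f U" "supp_in g U'" "U \<subseteq> W" "U' \<subseteq> W"
  shows "supp_in (f \<circ> g) W"
  using supp_in_comp[of f W g] supp_in_mono[of f U W] supp_in_mono[of g U' W] assms by blast

lemma supp_in_inv:
  assumes "bij f" "supp_in f U"
  shows "supp_in (inv f) U"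
  unfolding supp_in_def
proof (intro allI impI)
  fix x assume "x \<notin> U"
  then have fx: "f x = x" using assms(2) by (simp add: supp_in_def)
  show "inv f x = x" using bij_inv_simps(1)[OF assms(1), of x] unfolding fx .
qed

lemma supp_in_conj:
  assumes "bij c" "supp_in g U"
  shows "supp_in (c \<circ> g \<circ> inv c) (c ` U)"
proof -
  have "g (inv c x) = inv c x" if "x \<notin> c ` U" for x
  proof -
    have "inv c x \<notin> U"
    proof
      assume "inv c x \<in> U"
      then have "c (inv c x) \<in> c ` U" by (rule imageI)
      then show False using that assms(1) by simp
    qed
    then show ?thesis using assms by (simp add: supp_in_def)
  qed
  then show ?thesis using assms by (simp add: supp_in_def)
qed

lemma supp_in_image:
  assumes "supp_in g U" "bij g"
  shows "g ` U \<subseteq> U"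
proof (rule image_subsetI, rule ccontr)
  fix x assume x: "x \<in> U" "g x \<notin> U"
  then have "g (g x) = g x" using assms by (simp add: supp_in_def)
  then have "g x = x" using bij_is_inj[OF assms(2)] by (simp add: inj_eq)
  then show False using x by simp
qed

lemma disjoint_supp_commute:
  assumes "bij f" "bij g" "supp_in f U" "supp_in g W" "U \<inter> W = {}"
  shows "f \<circ> g = g \<circ> f"
proof
  fix x
  have U: "f x \<in> U" if "x \<in> U" using that supp_in_image assms by blast
  have W: "g x \<in> W" if "x \<in> W" using that supp_in_image assms by blast
  show "(f \<circ> g) x = (g \<circ> f) x"
  proof (cases "x \<in> U")
    case True
    then have "g x = x" "g (f x) = f x" using U assms by (auto simp: supp_in_def)
    then show ?thesis by simp
  next
    case x: False
    then have fx: "f x = x" using assms by (simp add: supp_in_def)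
    show ?thesis
    proof (cases "x \<in> W")
      case True
      then have "f (g x) = g x" using W assms by (auto simp: supp_in_def)
      then show ?thesis using fx by simp
    next
      case False
      then have "g x = x" using assms by (simp add: supp_in_def)
      then show ?thesis using fx by simp
    qed
  qed
qed

text \<open>Since \<open>p\<close> commutes with \<open>q \<circ> b \<circ> inv q\<close>, it meets
  its own inverse and cancels. A commutator thus forgets a factor that acts away from the other
  entry.\<close>

lemma comm_disjoint_left:
  assumes "bij p" "bij q" "bij b" "supp_in p U" "supp_in q W" "supp_in b W" "U \<inter> W = {}"
  shows "comm (p \<circ> q) b = comm q b"
proof -
  have "supp_in (q \<circ> b \<circ> inv q) W"
    using assms supp_in_comp supp_in_inv by blast
  then have c: "p \<circ> (q \<circ> b \<circ> inv q) = (q \<circ> b \<circ> inv q) \<circ> p"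
    using assms by (intro disjoint_supp_commute[of _ _ U W]) auto
  have "comm (p \<circ> q) b x = comm q b x" for x
    using fun_cong[OF c, of "inv p (inv b x)"] assms by (simp add: comm_apply)
  then show ?thesis by auto
qed

lemma comm_disjoint_right:
  assumes "bij p" "bij q" "bij b" "supp_in p U" "supp_in q W" "supp_in b W" "U \<inter> W = {}"
  shows "comm b (p \<circ> q) = comm b q"
proof -
  have "comm b (p \<circ> q) = inv (comm (p \<circ> q) b)" using assms by (simp add: inv_comm)
  also have "\<dots> = comm b q" using assms by (simp add: comm_disjoint_left[OF assms] inv_comm)
  finally show ?thesis .
qed

text \<open>The conjugation by \<open>a\<close> on the right-hand side is what forces the later
  passage to a set of maps invariant under the whole group.\<close>

lemma comm_comp_left:
  "bij a \<Longrightarrow> bij a' \<Longrightarrow> bij b \<Longrightarrow> comm (a \<circ> a') b = (a \<circ> comm a' b \<circ> inv a) \<circ> comm a b"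
  by (simp add: fun_eq_iff comm_apply)

lemma comm_comp_right:
  "bij a \<Longrightarrow> bij b \<Longrightarrow> bij b' \<Longrightarrow> comm a (b \<circ> b') = comm a b \<circ> (b \<circ> comm a b' \<circ> inv b)"
  by (simp add: fun_eq_iff comm_apply)

lemma conj_comm:
  "bij a \<Longrightarrow> bij b \<Longrightarrow> bij g \<Longrightarrow>
    g \<circ> comm a b \<circ> inv g = comm (g \<circ> a \<circ> inv g) (g \<circ> b \<circ> inv g)"
  by (simp add: fun_eq_iff comm_apply)

text \<open>An axiomatic form of the action on infinite words. \<open>V_swap\<close> does not demand
  that \<open>s\<close> be an involution, only that it copy \<open>g\<close> on \<open>W\<close> and
  leave everything outside \<open>W\<close> and its image alone.\<close>

locale ball_group =
  fixes \<Omega> :: "'a set" and balls :: "'a set set" and V :: "('a \<Rightarrow> 'a) set"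
  assumes ball: "B \<in> balls \<Longrightarrow> B \<subseteq> \<Omega> \<and> B \<noteq> {}"
    and ex_ball: "balls \<noteq> {}"
    and split: "B \<in> balls \<Longrightarrow> \<exists>B1\<in>balls. \<exists>B2\<in>balls. B1 \<subseteq> B \<and> B2 \<subseteq> B \<and> B1 \<inter> B2 = {}"
    and V_group: "perm_group V"
    and V_supp: "g \<in> V \<Longrightarrow> supp_in g \<Omega>"
    and ball_image: "g \<in> V \<Longrightarrow> B \<in> balls \<Longrightarrow> \<exists>B'\<in>balls. B' \<subseteq> g ` B"
    and V_compress: "Y \<in> balls \<Longrightarrow> B \<in> balls \<Longrightarrow>
      \<exists>c\<in>V. \<exists>Z\<in>balls. Z \<subseteq> Y \<and> c ` (\<Omega> - Y) \<subseteq> B \<and> supp_in c (\<Omega> - Z)"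
    and V_displace: "g \<in> V \<Longrightarrow> g \<noteq> id \<Longrightarrow> \<exists>W\<in>balls. g ` W \<inter> W = {}"
    and V_swap: "g \<in> V \<Longrightarrow> W \<in> balls \<Longrightarrow> g ` W \<inter> W = {} \<Longrightarrow>
      \<exists>s\<in>V. (\<forall>x\<in>W. s x = g x) \<and> supp_in s (W \<union> g ` W)"
begin

text \<open>Stated for arbitrary sets of maps, because \<open>comms S\<close> need not be a group.
  The ball \<open>Z\<close> that \<open>c\<close> fixes pointwise is what makes the property survive
  the passage to commutators.\<close>

definition compressing :: "('a \<Rightarrow> 'a) set \<Rightarrow> bool" where
  "compressing S \<longleftrightarrow> (\<forall>Y\<in>balls. \<forall>B\<in>balls.
      \<exists>c\<in>S. \<exists>Z\<in>balls. Z \<subseteq> Y \<and> c ` (\<Omega> - Y) \<subseteq> B \<and> supp_in c (\<Omega> - Z))"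

lemma compressing_mono:
  assumes "compressing S" "S \<subseteq> T"
  shows "compressing T"
  unfolding compressing_def
proof (intro ballI)
  fix Y B assume "Y \<in> balls" "B \<in> balls"
  then have "\<exists>c\<in>S. \<exists>Z\<in>balls. Z \<subseteq> Y \<and> c ` (\<Omega> - Y) \<subseteq> B \<and> supp_in c (\<Omega> - Z)"
    using assms(1) by (simp add: compressing_def)
  then show "\<exists>c\<in>T. \<exists>Z\<in>balls. Z \<subseteq> Y \<and> c ` (\<Omega> - Y) \<subseteq> B \<and> supp_in c (\<Omega> - Z)"
    by (rule bexE) (rule bexI[OF _ subsetD[OF assms(2)]])
qed

lemma compressingE:
  assumes "compressing S" "Y \<in> balls" "B \<in> balls"
  obtains c Z where "c \<in> S" "Z \<in> balls" "Z \<subseteq> Y" "c ` (\<Omega> - Y) \<subseteq> B" "supp_in c (\<Omega> - Z)"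
  using assms unfolding compressing_def by blast

lemma splitE:
  assumes "B \<in> balls"
  obtains B1 B2 where "B1 \<in> balls" "B2 \<in> balls" "B1 \<subseteq> B" "B2 \<subseteq> B" "B1 \<inter> B2 = {}"
  using split[OF assms] by blast

text \<open>The commutator of \<open>k\<close> with a map pushing the support of \<open>k\<close> into the ball \<open>Z\<close>
  that \<open>k\<close> fixes.\<close>

lemma comms_imitate:
  assumes S: "S \<subseteq> V" "compressing S" and k: "k \<in> S" "supp_in k (\<Omega> - Z)" and Z: "Z \<in> balls"
  obtains k' Z' where "k' \<in> comms S" "Z' \<in> balls" "Z' \<subseteq> Z" "supp_in k' (\<Omega> - Z')"
    "\<forall>x\<in>\<Omega> - Z. k' x = k x"
proof -
  \<comment> \<open>One half of \<open>Z\<close> receives the moved copy of \<open>inv k\<close>;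
    the other half stays fixed and serves as the new ball \<open>Z'\<close>.\<close>
  obtain Z1 Z2 where Z12: "Z1 \<in> balls" "Z2 \<in> balls" "Z1 \<subseteq> Z" "Z2 \<subseteq> Z" "Z1 \<inter> Z2 = {}"
    using splitE[OF Z] .
  obtain c where c: "c \<in> S" "c ` (\<Omega> - Z) \<subseteq> Z1"
    using compressingE[OF S(2) Z Z12(1)] by metis
  have bij: "bij c" "bij k" using S c k perm_groupD[OF V_group] by auto
  have "supp_in (c \<circ> inv k \<circ> inv c) (c ` (\<Omega> - Z))"
    using bij k by (intro supp_in_conj supp_in_inv) auto
  then have s: "supp_in (c \<circ> inv k \<circ> inv c) Z1"
    using c supp_in_mono by blast
  have eq: "comm k c = k \<circ> (c \<circ> inv k \<circ> inv c)"
    by (simp add: comm_def o_assoc)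
  have "comm k c x = k x" if "x \<in> \<Omega> - Z" for x
  proof -
    have "x \<notin> Z1" using that Z12 by blast
    then have "(c \<circ> inv k \<circ> inv c) x = x" using s by (simp add: supp_in_def)
    then show ?thesis by (simp add: eq)
  qed
  moreover have "supp_in (comm k c) (\<Omega> - Z2)"
    unfolding supp_in_def
  proof (intro allI impI)
    fix x assume x: "x \<notin> \<Omega> - Z2"
    then have "x \<notin> Z1" using Z12 ball by blast
    then have "(c \<circ> inv k \<circ> inv c) x = x" using s by (simp add: supp_in_def)
    moreover have "k x = x" using x k(2) Z12 by (auto simp: supp_in_def)
    ultimately show "comm k c x = x" by (simp add: eq)
  qed
  moreover have "comm k c \<in> comms S" using c k by (auto simp: comms_def)
  ultimately show ?thesis using that Z12 by blast
qed

text \<open>The imitating commutator agrees with \<open>k\<close> off \<open>Z\<close>, hence on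
  \<open>\<Omega> - Y\<close>, so it squeezes the same set into the same ball. Applied twice, this
  carries squeezing from \<open>V\<close> to \<open>G\<close> and from \<open>G\<close> to
  \<open>D\<close>.\<close>

lemma compressing_comms:
  assumes "S \<subseteq> V" "compressing S"
  shows "compressing (comms S)"
  unfolding compressing_def
proof (intro ballI)
  fix Y B assume YB: "Y \<in> balls" "B \<in> balls"
  obtain k Z where k: "k \<in> S" "Z \<in> balls" "Z \<subseteq> Y" "k ` (\<Omega> - Y) \<subseteq> B" "supp_in k (\<Omega> - Z)"
    using compressingE[OF assms(2) YB] .
  obtain k' Z' where k': "k' \<in> comms S" "Z' \<in> balls" "Z' \<subseteq> Z" "supp_in k' (\<Omega> - Z')"
    "\<forall>x\<in>\<Omega> - Z. k' x = k x"
    using comms_imitate[OF assms k(1,5,2)] .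
  have "k' ` (\<Omega> - Y) = k ` (\<Omega> - Y)"
    using k k'(5) by (intro image_cong) auto
  then show "\<exists>c\<in>comms S. \<exists>Z\<in>balls. Z \<subseteq> Y \<and> c ` (\<Omega> - Y) \<subseteq> B \<and> supp_in c (\<Omega> - Z)"
    using k k' by (intro bexI[of _ k'] bexI[of _ Z']) auto
qed

lemma compressing_V: "compressing V"
  using V_compress by (simp add: compressing_def)

section \<open>Normal subgroups of the derived group\<close>

context
  fixes G D
  assumes G: "perm_group G" "G \<subseteq> V" "comms V \<subseteq> G"
    and D: "perm_group D" "comms G \<subseteq> D" "\<And>K. perm_group K \<Longrightarrow> comms G \<subseteq> K \<Longrightarrow> D \<subseteq> K"
begin

lemma compressing_G: "compressing G"
  using compressing_mono[OF compressing_comms[OF order_refl compressing_V] G(3)] .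

lemma compressing_D: "compressing D"
  using compressing_mono[OF compressing_comms[OF G(2) compressing_G] D(2)] .

text \<open>If the identity were a squeezing map, it would place \<open>Y2\<close> inside
  \<open>W2\<close>, although \<open>Y2\<close> is nonempty and lies in \<open>W1\<close>, which is
  disjoint from \<open>W2\<close>.\<close>

lemma D_nontrivial: "D \<noteq> {id}"
proof
  assume "D = {id}"
  obtain W where W: "W \<in> balls" using ex_ball by blast
  obtain W1 W2 where W12: "W1 \<in> balls" "W2 \<in> balls" "W1 \<subseteq> W" "W2 \<subseteq> W" "W1 \<inter> W2 = {}"
    using splitE[OF W] .
  obtain Y1 Y2 where Y12: "Y1 \<in> balls" "Y2 \<in> balls" "Y1 \<subseteq> W1" "Y2 \<subseteq> W1" "Y1 \<inter> Y2 = {}"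
    using splitE[OF W12(1)] .
  obtain c where "c \<in> D" "c ` (\<Omega> - Y1) \<subseteq> W2"
    using compressingE[OF compressing_D Y12(1) W12(2)] by metis
  then have "\<Omega> - Y1 \<subseteq> W2" using \<open>D = {id}\<close> by simp
  then show False using ball[OF Y12(2)] Y12 W12 by blast
qed

context
  fixes N
  assumes N: "perm_group N" "N \<subseteq> D" "\<And>g x. g \<in> D \<Longrightarrow> x \<in> N \<Longrightarrow> g \<circ> x \<circ> inv g \<in> N" "N \<noteq> {id}"
begin

lemma bij_G: "g \<in> G \<Longrightarrow> bij g"
  using perm_groupD[OF G(1)] by blast

lemma conj_G: "g \<in> G \<Longrightarrow> a \<in> G \<Longrightarrow> g \<circ> a \<circ> inv g \<in> G"
  using perm_groupD[OF G(1)] by simp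

lemma bij_D: "g \<in> D \<Longrightarrow> bij g"
  using perm_groupD[OF D(1)] by blast

lemma comm_D: "f \<in> G \<Longrightarrow> g \<in> G \<Longrightarrow> comm f g \<in> D"
  using D by (auto simp: comms_def)

text \<open>A double commutator with a displacing element of \<open>N\<close> reproduces commutators of elements
  of \<open>D\<close>; \<open>a\<close> and \<open>b\<close> are turned into elements of \<open>D\<close> by adding inverse copies of them
  with supports disjoint from everything else.\<close>

lemma N_ball:
  obtains B where "B \<in> balls"
    "\<And>a b. a \<in> G \<Longrightarrow> b \<in> G \<Longrightarrow> supp_in a B \<Longrightarrow> supp_in b B \<Longrightarrow> comm a b \<in> N"
proof -
  obtain n where n: "n \<in> N" "n \<noteq> id" using N perm_groupD[OF N(1)] by blast
  have DG: "D \<subseteq> G" using D(3)[OF G(1)] comm_in[OF G(1)] by (auto simp: comms_def)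
  then have nV: "n \<in> V" using n N G by blast
  then have bn: "bij n" using perm_groupD[OF V_group] by blast
  obtain W where W: "W \<in> balls" "n ` W \<inter> W = {}" using V_displace[OF nV n(2)] by blast
  obtain W1 W2 where W12: "W1 \<in> balls" "W2 \<in> balls" "W1 \<subseteq> W" "W2 \<subseteq> W" "W1 \<inter> W2 = {}"
    using splitE[OF W(1)] .
  obtain B B2 where B12: "B \<in> balls" "B2 \<in> balls" "B \<subseteq> W1" "B2 \<subseteq> W1" "B \<inter> B2 = {}"
    using splitE[OF W12(1)] .
  \<comment> \<open>The spare ball \<open>Y\<close> is disjoint from \<open>B\<close>, so maps
    squeezing its complement can carry the supports of \<open>a\<close> and \<open>b\<close> into
    \<open>B2\<close> and \<open>B3\<close>.\<close>
  obtain B3 Y where B3: "B3 \<in> balls" "Y \<in> balls" "B3 \<subseteq> W2" "Y \<subseteq> W2" "B3 \<inter> Y = {}"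
    using splitE[OF W12(2)] .
  have BY: "B \<subseteq> \<Omega> - Y" using B12 B3 W12 ball by blast
  obtain c where c: "c \<in> G" "c ` (\<Omega> - Y) \<subseteq> B2"
    using compressingE[OF compressing_G B3(2) B12(2)] by metis
  obtain e where e: "e \<in> G" "e ` (\<Omega> - Y) \<subseteq> B3"
    using compressingE[OF compressing_G B3(2) B3(1)] by metis
  have "comm a b \<in> N" if ab: "a \<in> G" "b \<in> G" "supp_in a B" "supp_in b B" for a b
  proof -
    have bij [simp]: "bij a" "bij b" "bij c" "bij e" "bij n" using ab c e bn bij_G by auto
    define r s where "r = c \<circ> inv a \<circ> inv c" and "s = e \<circ> inv b \<circ> inv e"
    have [simp]: "bij r" "bij s" by (simp_all add: r_def s_def)
    have "supp_in r (c ` B)" "supp_in s (e ` B)"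
      unfolding r_def s_def using ab by (auto intro!: supp_in_conj supp_in_inv)
    moreover have "c ` B \<subseteq> B2" "e ` B \<subseteq> B3" using c(2) e(2) BY by blast+
    ultimately have r: "supp_in r B2" and s: "supp_in s B3"
      by (simp_all add: supp_in_mono)
    define a' b' where "a' = r \<circ> a" and "b' = s \<circ> b"
    have [simp]: "bij a'" "bij b'" by (simp_all add: a'_def b'_def)
    have "a' = comm c (inv a)" "b' = comm e (inv b)"
      by (simp_all add: a'_def b'_def r_def s_def comm_def)
    then have D': "a' \<in> D" "b' \<in> D"
      using c e ab perm_groupD(3)[OF G(1)] comm_D by simp_all
    have sub: "B \<subseteq> W" "B2 \<subseteq> W" "B3 \<subseteq> W" using B12 B3 W12 by auto
    have supp': "supp_in a' W" "supp_in b' W"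
      unfolding a'_def b'_def using supp_in_comp_mono r s ab sub by blast+
    have "supp_in b' (B \<union> B3)"
      unfolding b'_def using supp_in_comp_mono s ab by blast
    moreover have "supp_in a (B \<union> B3)" using ab supp_in_mono by blast
    moreover have "B2 \<inter> (B \<union> B3) = {}" using B12 B3 W12 by blast
    ultimately have "comm a' b' = comm a b'"
      unfolding a'_def using r by (intro comm_disjoint_left[of _ _ _ B2 "B \<union> B3"]) auto
    also have "\<dots> = comm a b"
      unfolding b'_def using s ab B12 B3 W12
      by (intro comm_disjoint_right[of _ _ _ B3 B]) auto
    finally have 1: "comm a' b' = comm a b" .
    define p where "p = n \<circ> inv a' \<circ> inv n"
    have [simp]: "bij p" by (simp add: p_def)
    have p: "supp_in p (n ` W)"
      unfolding p_def using supp' by (intro supp_in_conj supp_in_inv) auto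
    have m: "comm a' n = p \<circ> a'"
      using disjoint_supp_commute[of p a' "n ` W" W] p supp' W
      by (simp add: comm_def p_def o_assoc)
    have mN: "comm a' n \<in> N"
      unfolding comm_def using N(3)[OF D'(1) n(1)] n by (simp add: perm_groupD(3,4)[OF N(1)])
    \<comment> \<open>The factor \<open>p\<close> lives on the image of \<open>W\<close> under
      \<open>n\<close>, away from the supports of \<open>a'\<close> and \<open>b'\<close>, and drops
      out.\<close>
    have "comm (comm a' n) b' = comm a' b'"
      unfolding m using p supp' W by (intro comm_disjoint_left[of _ _ _ "n ` W" W]) auto
    moreover have "comm (comm a' n) b' \<in> N"
    proof -
      have "b' \<circ> inv (comm a' n) \<circ> inv b' \<in> N"
        using N(3)[OF D'(2)] mN perm_groupD(3)[OF N(1)] by blast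
      then have "comm a' n \<circ> (b' \<circ> inv (comm a' n) \<circ> inv b') \<in> N"
        using mN perm_groupD(4)[OF N(1)] by blast
      then show ?thesis by (simp add: comm_def[of "comm a' n"] o_assoc)
    qed
    ultimately show ?thesis using 1 by simp
  qed
  then show ?thesis using that B12 by blast
qed

text \<open>A squeezing map \<open>k\<close> carries both supports into the ball of
  \<open>N_ball\<close>. As \<open>k\<close> can be chosen in \<open>D\<close>, normality of
  \<open>N\<close> allows conjugating back.\<close>

lemma N_fix_ball:
  assumes "a \<in> G" "b \<in> G" "supp_in a (\<Omega> - Y)" "supp_in b (\<Omega> - Y)" "Y \<in> balls"
  shows "comm a b \<in> N"
proof -
  obtain B where B: "B \<in> balls"
    "\<And>a b. a \<in> G \<Longrightarrow> b \<in> G \<Longrightarrow> supp_in a B \<Longrightarrow> supp_in b B \<Longrightarrow> comm a b \<in> N"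
    using N_ball by blast
  obtain k where k: "k \<in> D" "k ` (\<Omega> - Y) \<subseteq> B"
    using compressingE[OF compressing_D assms(5) B(1)] by metis
  have DG: "D \<subseteq> G" using D(3)[OF G(1)] comm_in[OF G(1)] by (auto simp: comms_def)
  have bij [simp]: "bij a" "bij b" "bij k" using assms k bij_G bij_D by auto
  have "supp_in (k \<circ> a \<circ> inv k) B" "supp_in (k \<circ> b \<circ> inv k) B"
    using supp_in_mono[OF supp_in_conj[OF bij(3)]] assms k by blast+
  moreover have "k \<circ> a \<circ> inv k \<in> G" "k \<circ> b \<circ> inv k \<in> G"
    using k DG assms conj_G by auto
  ultimately have "k \<circ> comm a b \<circ> inv k \<in> N"
    using B(2) by (simp add: conj_comm)
  then have "inv k \<circ> (k \<circ> comm a b \<circ> inv k) \<circ> inv (inv k) \<in> N"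
    using N(3) k perm_groupD(3)[OF D(1)] by blast
  also have "inv k \<circ> (k \<circ> comm a b \<circ> inv k) \<circ> inv (inv k) = comm a b"
    by (simp add: fun_eq_iff)
  finally show ?thesis .
qed

text \<open>The intersection of all conjugates of \<open>N\<close> under \<open>G\<close>. Unlike
  \<open>N\<close>, it is visibly invariant under \<open>G\<close>, so commutator identities for
  elements of \<open>G\<close> can be applied modulo it.\<close>

definition core where "core = {x. bij x \<and> (\<forall>g\<in>G. g \<circ> x \<circ> inv g \<in> N)}"

lemma perm_group_core: "perm_group core"
  unfolding perm_group_def
proof (intro conjI ballI)
  have "g \<circ> inv g = id" if "g \<in> G" for g
    using bij_G[OF that] by (simp add: fun_eq_iff)
  then show "id \<in> core" using perm_groupD(1)[OF N(1)] by (simp add: core_def)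
  fix f assume f: "f \<in> core"
  then show bf: "bij f" by (simp add: core_def)
  have "g \<circ> inv f \<circ> inv g = inv (g \<circ> f \<circ> inv g)" if "g \<in> G" for g
    using bij_G[OF that] bf by (simp add: fun_eq_iff)
  then show "inv f \<in> core" using f perm_groupD[OF N(1)] by (auto simp: core_def)
  fix g assume g: "g \<in> core"
  have "h \<circ> (f \<circ> g) \<circ> inv h = (h \<circ> f \<circ> inv h) \<circ> (h \<circ> g \<circ> inv h)" if "h \<in> G" for h
    using bij_G[OF that] by (simp add: fun_eq_iff)
  then show "f \<circ> g \<in> core" using f g perm_groupD[OF N(1)] by (auto simp: core_def)
qed

lemma core_conj:
  assumes "g \<in> G" "x \<in> core"
  shows "g \<circ> x \<circ> inv g \<in> core"
proof -
  have "h \<circ> (g \<circ> x \<circ> inv g) \<circ> inv h = (h \<circ> g) \<circ> x \<circ> inv (h \<circ> g)" if "h \<in> G" for h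
    using bij_G assms that by (simp add: fun_eq_iff)
  then show ?thesis using assms bij_G perm_groupD[OF G(1)] by (auto simp: core_def)
qed

text \<open>Conjugation by \<open>g\<close> moves the fixed ball \<open>Y\<close> to its image under
  \<open>g\<close>, which contains another ball. Hence \<open>N_fix_ball\<close> applies to every
  conjugate of the commutator.\<close>

lemma core_fix_ball:
  assumes "a \<in> G" "b \<in> G" "supp_in a (\<Omega> - Y)" "supp_in b (\<Omega> - Y)" "Y \<in> balls"
  shows "comm a b \<in> core"
  unfolding core_def
proof (intro CollectI conjI ballI)
  show "bij (comm a b)" using assms bij_G by simp
  fix g assume g: "g \<in> G"
  have bij [simp]: "bij a" "bij b" "bij g" using assms g bij_G by auto
  obtain B where B: "B \<in> balls" "B \<subseteq> g ` Y" using ball_image[of g Y] assms g G by blast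
  have "supp_in g \<Omega>" using g G V_supp by blast
  then have "g ` \<Omega> \<subseteq> \<Omega>" by (rule supp_in_image) simp
  moreover have "g ` (\<Omega> - Y) \<inter> g ` Y = {}"
    using bij_is_inj[OF bij(3)] by (auto dest: injD)
  ultimately have "g ` (\<Omega> - Y) \<subseteq> \<Omega> - B"
    using B by blast
  then have "supp_in (g \<circ> a \<circ> inv g) (\<Omega> - B)" "supp_in (g \<circ> b \<circ> inv g) (\<Omega> - B)"
    using supp_in_mono[OF supp_in_conj[OF bij(3)]] assms by blast+
  moreover have "g \<circ> a \<circ> inv g \<in> G" "g \<circ> b \<circ> inv g \<in> G"
    using g assms conj_G by auto
  ultimately show "g \<circ> comm a b \<circ> inv g \<in> N"
    using N_fix_ball B by (simp add: conj_comm)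
qed

lemma core_comm_left:
  assumes "a \<in> G" "a' \<in> G" "b \<in> G" "comm a b \<in> core" "comm a' b \<in> core"
  shows "comm (a \<circ> a') b \<in> core"
  using assms bij_G by (simp add: comm_comp_left core_conj perm_groupD[OF perm_group_core])

lemma core_comm_right:
  assumes "a \<in> G" "b' \<in> G" "b \<in> G" "comm a b \<in> core" "comm a b' \<in> core"
  shows "comm a (b \<circ> b') \<in> core"
  using assms bij_G by (simp add: comm_comp_right core_conj perm_groupD[OF perm_group_core])

text \<open>Modulo the core, \<open>a\<close> equals its conjugate by a map \<open>c\<close> which pushes the support of \<open>a\<close>
  into the ball fixed by \<open>b\<close>.\<close>

lemma core_comm_fix:
  assumes a: "a \<in> G" "supp_in a (\<Omega> - S)" "S \<in> balls"
    and b: "b \<in> G" "supp_in b (\<Omega> - Y)" "Y \<in> balls"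
  shows "comm a b \<in> core"
proof -
  obtain c Z where c: "c \<in> G" "Z \<in> balls" "Z \<subseteq> S" "c ` (\<Omega> - S) \<subseteq> Y" "supp_in c (\<Omega> - Z)"
    using compressingE[OF compressing_G a(3) b(3)] .
  have bij [simp]: "bij a" "bij b" "bij c" using a b c bij_G by auto
  define a1 where "a1 = c \<circ> a \<circ> inv c"
  have [simp]: "bij a1" by (simp add: a1_def)
  have "supp_in a (\<Omega> - Z)" using a c by (auto intro: supp_in_mono)
  then have q: "comm a c \<in> core" using core_fix_ball a c by blast
  have "supp_in a1 Y"
    unfolding a1_def using supp_in_conj[OF bij(3) a(2)] c supp_in_mono by blast
  then have cm: "a1 \<circ> b = b \<circ> a1"
    using b by (intro disjoint_supp_commute[of _ _ Y "\<Omega> - Y"]) auto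
  have "a = comm a c \<circ> a1" by (simp add: fun_eq_iff a1_def comm_apply)
  moreover have "comm a1 b = id"
    by (simp add: comm_def cm) (simp add: fun_eq_iff)
  ultimately have "comm a b = comm (comm a c) b"
    using comm_comp_left[of "comm a c" a1 b] by (metis (no_types, lifting) bij bij_comm comp_id
      \<open>bij a1\<close> bij_is_surj id_comp surj_iff)
  also have "\<dots> = comm a c \<circ> (b \<circ> inv (comm a c) \<circ> inv b)"
    by (simp add: comm_def[of "comm a c"] o_assoc)
  also have "\<dots> \<in> core"
    using q b core_conj perm_groupD(3,4)[OF perm_group_core] by simp
  finally show ?thesis .
qed

text \<open>A map copying \<open>g\<close> on a small ball while fixing another ball exists in
  \<open>V\<close>, but perhaps not in \<open>G\<close>. A commutator of elements of
  \<open>V\<close> copies it off the fixed ball and does lie in \<open>G\<close>; dividing it out of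
  \<open>g\<close> leaves a map fixing the small ball.\<close>

lemma G_factor:
  assumes g: "g \<in> G"
  obtains k1 k2 X1 X2 where "g = k1 \<circ> k2" "k1 \<in> G" "k2 \<in> G" "X1 \<in> balls" "X2 \<in> balls"
    "supp_in k1 (\<Omega> - X1)" "supp_in k2 (\<Omega> - X2)"
proof (cases "g = id")
  case True
  obtain S where "S \<in> balls" using ex_ball by blast
  then show ?thesis using that[of id id S S] True g by (simp add: supp_in_def)
next
  case False
  have gV: "g \<in> V" using g G by blast
  obtain W where W: "W \<in> balls" "g ` W \<inter> W = {}" using V_displace[OF gV False] by blast
  obtain W1 W2 where W12: "W1 \<in> balls" "W2 \<in> balls" "W1 \<subseteq> W" "W2 \<subseteq> W" "W1 \<inter> W2 = {}"
    using splitE[OF W(1)] .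
  have "g ` W1 \<inter> W1 = {}" using W W12 by blast
  then obtain s where s: "s \<in> V" "\<forall>x\<in>W1. s x = g x" "supp_in s (W1 \<union> g ` W1)"
    using V_swap[OF gV W12(1)] by blast
  have "W1 \<union> g ` W1 \<subseteq> - W2" using W W12 by blast
  then have "supp_in s (- W2)" using s supp_in_mono by blast
  moreover have "supp_in s \<Omega>" using s V_supp by blast
  ultimately have s': "supp_in s (\<Omega> - W2)" by (auto simp: supp_in_def)
  obtain k Z where k: "k \<in> comms V" "Z \<in> balls" "Z \<subseteq> W2" "supp_in k (\<Omega> - Z)"
    "\<forall>x\<in>\<Omega> - W2. k x = s x"
    using comms_imitate[OF order_refl compressing_V s(1) s' W12(2)] .
  have kG: "k \<in> G" using k G by blast
  have bij [simp]: "bij k" "bij g" using kG g bij_G by auto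
  have kg: "inv k \<circ> g \<in> G" using kG g by (simp add: perm_groupD(3,4)[OF G(1)])
  have "k x = g x" if "x \<in> W1" for x
  proof -
    have "x \<in> \<Omega> - W2" using that ball[OF W12(1)] W12 by blast
    then show ?thesis using that k(5) s by simp
  qed
  then have "inv k (g x) = x" if "x \<in> W1" for x
    using that bij_inv_simps(1)[OF bij(1), of x] by simp
  moreover have "supp_in (inv k \<circ> g) \<Omega>" using kg G V_supp by blast
  ultimately have "supp_in (inv k \<circ> g) (\<Omega> - W1)" by (auto simp: supp_in_def)
  moreover have "g = k \<circ> (inv k \<circ> g)" by (simp add: fun_eq_iff)
  ultimately show ?thesis using that[of k "inv k \<circ> g" Z W1] kG kg k W12 by blast
qed

lemma D_subset_N: "D \<subseteq> N"
proof -
  have "comm f g \<in> core" if fg: "f \<in> G" "g \<in> G" for f g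
  proof -
    obtain f1 f2 X1 X2 where f: "f = f1 \<circ> f2" "f1 \<in> G" "f2 \<in> G" "X1 \<in> balls" "X2 \<in> balls"
      "supp_in f1 (\<Omega> - X1)" "supp_in f2 (\<Omega> - X2)" using G_factor[OF fg(1)] .
    obtain g1 g2 Y1 Y2 where g: "g = g1 \<circ> g2" "g1 \<in> G" "g2 \<in> G" "Y1 \<in> balls" "Y2 \<in> balls"
      "supp_in g1 (\<Omega> - Y1)" "supp_in g2 (\<Omega> - Y2)" using G_factor[OF fg(2)] .
    have "comm f h \<in> core" if "h \<in> G" "supp_in h (\<Omega> - Y)" "Y \<in> balls" for h Y
      unfolding f(1) using core_comm_left[OF f(2,3) that(1)] core_comm_fix[OF _ _ _ that] f by blast
    then have "comm f g1 \<in> core" "comm f g2 \<in> core"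
      using g by blast+
    then show ?thesis unfolding g(1) using core_comm_right fg g by blast
  qed
  then have "comms G \<subseteq> core" by (auto simp: comms_def)
  then have "D \<subseteq> core" using D(3) perm_group_core by blast
  \<comment> \<open>Conjugation by \<open>id\<close> is one of the conjugations in the definition of
    \<open>core\<close>.\<close>
  also have "core \<subseteq> N" using perm_groupD[OF G(1)] by (force simp: core_def)
  finally show ?thesis .
qed

end

end

end

section \<open>The group of local similarities of the space of infinite words\<close>

definition pre :: "(nat \<Rightarrow> nat) \<Rightarrow> nat \<Rightarrow> nat list" where
  "pre x n = map x [0..<n]"

lemma length_pre [simp]: "length (pre x n) = n"
  by (simp add: pre_def)

lemma nth_pre [simp]: "i < n \<Longrightarrow> pre x n ! i = x i"
  by (simp add: pre_def)

lemma conc_Nil [simp]: "conc [] y = y"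
  by (simp add: conc_def)

lemma conc_append: "conc (u @ v) y = conc u (conc v y)"
  by (auto simp: conc_def nth_append fun_eq_iff)

lemma conc_map: "s \<circ> conc w y = conc (map s w) (s \<circ> y)"
  by (auto simp: conc_def fun_eq_iff)

lemma conc_add: "conc w y (length w + i) = y i"
  by (simp add: conc_def)

lemma conc_inj [simp]: "conc w x = conc w y \<longleftrightarrow> x = y"
  by (metis conc_add ext)

lemma conc_eq_append_iff: "length w = length w' \<Longrightarrow> conc w x = conc w' y \<longleftrightarrow> w = w' \<and> x = y"
proof
  assume l: "length w = length w'" and eq: "conc w x = conc w' y"
  have "w ! i = w' ! i" if "i < length w" for i
    using fun_cong[OF eq, of i] that l by (simp add: conc_def)
  then have "w = w'" using l by (simp add: nth_equalityI)
  then show "w = w' \<and> x = y" using eq by simp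
qed simp

lemma conc_mem [simp]: "w \<in> fwords d \<Longrightarrow> conc w y \<in> iwords d \<longleftrightarrow> y \<in> iwords d"
proof
  assume "conc w y \<in> iwords d"
  then have "conc w y (length w + i) \<in> {1..d}" for i unfolding iwords_def by blast
  then show "y \<in> iwords d" by (simp add: conc_add iwords_def)
qed (auto simp: iwords_def fwords_def conc_def dest!: nth_mem)

lemma fwords_append [simp]: "u @ v \<in> fwords d \<longleftrightarrow> u \<in> fwords d \<and> v \<in> fwords d"
  by (auto simp: fwords_def)

lemma fwords_Nil [simp]: "[] \<in> fwords d"
  by (simp add: fwords_def)

lemma fwords_Cons [simp]: "a # v \<in> fwords d \<longleftrightarrow> a \<in> {1..d} \<and> v \<in> fwords d"
  by (auto simp: fwords_def)

lemma pre_mem [simp]: "x \<in> iwords d \<Longrightarrow> pre x n \<in> fwords d"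
  by (auto simp: pre_def fwords_def iwords_def)

lemma conc_pre: "conc (pre x n) (\<lambda>i. x (n + i)) = x"
  by (auto simp: conc_def fun_eq_iff)

lemma shift_mem [simp]: "x \<in> iwords d \<Longrightarrow> (\<lambda>i. x (n + i)) \<in> iwords d"
  by (simp add: iwords_def)

lemma mem_cyl_iff: "x \<in> cyl d w \<longleftrightarrow> x \<in> iwords d \<and> pre x (length w) = w"
  by (auto simp: cyl_def list_eq_iff_nth_eq)

lemma mem_cyl_pre [simp]: "x \<in> iwords d \<Longrightarrow> x \<in> cyl d (pre x n)"
  by (simp add: mem_cyl_iff)

lemma pre_conc [simp]: "pre (conc w y) (length w) = w"
  by (simp add: list_eq_iff_nth_eq conc_def)

lemma cyl_eq_image: "w \<in> fwords d \<Longrightarrow> cyl d w = conc w ` iwords d"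
proof (intro Set.set_eqI iffI)
  fix x assume "x \<in> cyl d w"
  then show "x \<in> conc w ` iwords d"
    by (metis conc_pre image_eqI mem_cyl_iff shift_mem)
qed (auto simp: mem_cyl_iff)

lemma conc_mem_cyl [simp]: "w \<in> fwords d \<Longrightarrow> y \<in> iwords d \<Longrightarrow> conc w y \<in> cyl d w"
  by (simp add: cyl_eq_image)

lemma cyl_append: "cyl d (u @ v) \<subseteq> cyl d u"
  by (force simp: cyl_def nth_append)

lemma pre_le:
  assumes "m \<le> n" "x \<in> iwords d"
  obtains v where "v \<in> fwords d" "pre x n = pre x m @ v"
proof
  show "pre x n = pre x m @ map x [m..<n]"
    using assms(1) by (metis le_add_diff_inverse less_eq_nat.simps(1) map_append pre_def upt_add_eq_append)
  show "map x [m..<n] \<in> fwords d" using assms(2) by (auto simp: fwords_def iwords_def)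
qed

lemma cyl_pre_anti: "m \<le> n \<Longrightarrow> cyl d (pre x n) \<subseteq> cyl d (pre x m)"
  by (auto simp: cyl_def)

section \<open>Open sets, prefixes and the metric\<close>

definition wopen :: "nat \<Rightarrow> (nat \<Rightarrow> nat) set \<Rightarrow> bool" where
  "wopen d U \<longleftrightarrow> (\<forall>x\<in>U. \<exists>n. cyl d (pre x n) \<subseteq> U)"

lemma wopen_Un: "wopen d U \<Longrightarrow> wopen d W \<Longrightarrow> wopen d (U \<union> W)"
  unfolding wopen_def by (meson UnE le_supI1 le_supI2)

lemma wopen_Int:
  assumes "wopen d U" "wopen d W"
  shows "wopen d (U \<inter> W)"
  unfolding wopen_def
proof
  fix x assume "x \<in> U \<inter> W"
  then obtain m n where "cyl d (pre x m) \<subseteq> U" "cyl d (pre x n) \<subseteq> W"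
    using assms unfolding wopen_def by blast
  then have "cyl d (pre x (max m n)) \<subseteq> U \<inter> W"
    using cyl_pre_anti[of m "max m n" d x] cyl_pre_anti[of n "max m n" d x] by auto
  then show "\<exists>n. cyl d (pre x n) \<subseteq> U \<inter> W" by blast
qed

lemma wopen_cyl: "wopen d (cyl d w)"
  unfolding wopen_def by (metis mem_cyl_iff order_refl)

lemma wopen_Compl_cyl: "wopen d (iwords d - cyl d w)"
  unfolding wopen_def
proof
  fix x assume "x \<in> iwords d - cyl d w"
  then have "cyl d (pre x (length w)) \<subseteq> iwords d - cyl d w"
    by (auto simp: mem_cyl_iff)
  then show "\<exists>n. cyl d (pre x n) \<subseteq> iwords d - cyl d w" by blast
qed

text \<open>The distance is \<open>exp (- n)\<close> for the first difference \<open>n\<close>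
  counted from 0. The strict bound therefore gives agreement up to and including position
  \<open>k\<close>, one position more than \<open>wdist_le\<close> asks for.\<close>

lemma wdist_less:
  assumes "wdist y x < exp (- real k)" "i \<le> k"
  shows "y i = x i"
proof (rule ccontr)
  assume ne: "y i \<noteq> x i"
  then have "(LEAST i. y i \<noteq> x i) \<le> i" by (rule Least_le)
  moreover have "wdist y x = exp (- real (LEAST i. y i \<noteq> x i))"
    using ne by (auto simp: wdist_def)
  ultimately show False using assms by simp
qed

lemma wdist_le:
  assumes "\<And>i. i < k \<Longrightarrow> y i = x i"
  shows "wdist y x \<le> exp (- real k)"
proof (cases "y = x")
  case False
  then have "\<exists>i. y i \<noteq> x i" by auto
  then have "y (LEAST i. y i \<noteq> x i) \<noteq> x (LEAST i. y i \<noteq> x i)" by (rule LeastI_ex)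
  then have "k \<le> (LEAST i. y i \<noteq> x i)" using assms by (meson not_less)
  then show ?thesis using False by (simp add: wdist_def)
qed (simp add: wdist_def)

definition acts :: "nat \<Rightarrow> ((nat \<Rightarrow> nat) \<Rightarrow> nat \<Rightarrow> nat) \<Rightarrow> nat list \<Rightarrow> nat list \<Rightarrow> (nat \<Rightarrow> nat) \<Rightarrow> bool" where
  "acts d g w u s \<longleftrightarrow> (\<forall>y\<in>iwords d. g (conc w y) = conc u (s \<circ> y))"

text \<open>The local condition of \<open>Vd\<close>, attached to a word instead of a point; in this
  form it passes to all extensions of the word.\<close>

definition good :: "nat \<Rightarrow> (nat \<Rightarrow> nat) set \<Rightarrow> ((nat \<Rightarrow> nat) \<Rightarrow> nat \<Rightarrow> nat) \<Rightarrow> nat list \<Rightarrow> bool" where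
  "good d H g w \<longleftrightarrow> (\<exists>u\<in>fwords d. \<exists>s\<in>H. acts d g w u s)"

locale words =
  fixes d :: nat and H :: "(nat \<Rightarrow> nat) set"
  assumes d: "2 \<le> d" and H: "subgroup H (sym_group d)"
begin

lemma H_permutes: "s \<in> H \<Longrightarrow> s permutes {1..d}"
  using subgroup.subset[OF H] sym_group_carrier by blast

lemma H_id: "id \<in> H"
  using subgroup.one_closed[OF H] by (simp add: sym_group_one)

lemma H_comp: "s \<in> H \<Longrightarrow> t \<in> H \<Longrightarrow> s \<circ> t \<in> H"
  using subgroup.m_closed[OF H] by (simp add: sym_group_mult)

lemma H_inv: "s \<in> H \<Longrightarrow> inv s \<in> H"
  using subgroup.m_inv_closed[OF H] subgroup.subset[OF H] sym_group_inv_equality by fastforce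

lemma H_mem: "s \<in> H \<Longrightarrow> a \<in> {1..d} \<Longrightarrow> s a \<in> {1..d}"
  by (simp only: permutes_in_image[OF H_permutes])

lemma H_iwords [simp]: "s \<in> H \<Longrightarrow> y \<in> iwords d \<Longrightarrow> s \<circ> y \<in> iwords d"
  using H_mem by (simp add: iwords_def)

lemma H_fwords [simp]: "s \<in> H \<Longrightarrow> w \<in> fwords d \<Longrightarrow> map s w \<in> fwords d"
  using H_mem by (auto simp: fwords_def)

lemma H_inv_o [simp]: "s \<in> H \<Longrightarrow> s \<circ> (inv s \<circ> y) = y" "s \<in> H \<Longrightarrow> inv s \<circ> (s \<circ> y) = y"
  using permutes_inverses[OF H_permutes] by (simp_all add: fun_eq_iff)

lemma const_mem [simp]: "(\<lambda>_. 1) \<in> iwords d"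
  using d by (simp add: iwords_def)

lemma acts_append:
  assumes "acts d g w u s" "v \<in> fwords d"
  shows "acts d g (w @ v) (u @ map s v) s"
  using assms by (simp add: acts_def conc_append conc_map)

lemma good_append:
  assumes "good d H g w" "v \<in> fwords d"
  shows "good d H g (w @ v)"
proof -
  obtain u s where "u \<in> fwords d" "s \<in> H" "acts d g w u s" using assms by (auto simp: good_def)
  then show ?thesis using acts_append[of g w u s v] assms(2)
    unfolding good_def by (meson H_fwords fwords_append)
qed

lemma good_pre_mono:
  assumes "good d H g (pre x m)" "m \<le> n" "x \<in> iwords d"
  shows "good d H g (pre x n)"
  using good_append[OF assms(1)] pre_le[OF assms(2,3)] by metis

lemma acts_image:
  assumes "acts d g w u s" "w \<in> fwords d" "u \<in> fwords d" "s \<in> H"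
  shows "g ` cyl d w = cyl d u"
proof (intro Set.set_eqI iffI)
  fix x assume "x \<in> g ` cyl d w"
  then show "x \<in> cyl d u" using assms by (auto simp: cyl_eq_image acts_def)
next
  fix x assume "x \<in> cyl d u"
  then obtain y where y: "y \<in> iwords d" "x = conc u y" using assms by (auto simp: cyl_eq_image)
  have "x = g (conc w (inv s \<circ> y))"
    using assms y H_inv by (simp add: acts_def)
  moreover have "conc w (inv s \<circ> y) \<in> cyl d w"
    using assms y H_inv by simp
  ultimately show "x \<in> g ` cyl d w" by blast
qed

lemma good_cyl:
  assumes "good d H g w" "w \<in> fwords d"
  obtains u s where "u \<in> fwords d" "s \<in> H" "acts d g w u s" "g ` cyl d w = cyl d u"
proof -
  obtain u s where u: "u \<in> fwords d" "s \<in> H" "acts d g w u s" using assms by (auto simp: good_def)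
  show ?thesis using that u acts_image[OF u(3) assms(2) u(1,2)] by blast
qed

lemma good_id [simp]: "w \<in> fwords d \<Longrightarrow> good d H id w"
  unfolding good_def acts_def using H_id by (intro bexI[of _ w] bexI[of _ id]) auto

lemma good_inv:
  assumes "bij g" "u \<in> fwords d" "w \<in> fwords d" "s \<in> H" "acts d g w u s"
  shows "good d H (inv g) u"
  unfolding good_def
proof (intro bexI)
  show "inv s \<in> H" using assms H_inv by blast
  show "acts d (inv g) u w (inv s)"
    unfolding acts_def
  proof
    fix y assume "y \<in> iwords d"
    then have "g (conc w (inv s \<circ> y)) = conc u y"
      using assms H_inv by (simp add: acts_def)
    then show "inv g (conc u y) = conc w (inv s \<circ> y)"
      using assms(1) by (metis bij_inv_simps(1))
  qed
qed (use assms in auto)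

lemma good_cong:
  assumes "\<And>x. x \<in> cyl d w \<Longrightarrow> f x = g x" "w \<in> fwords d"
  shows "good d H f w \<longleftrightarrow> good d H g w"
  using assms by (simp add: good_def acts_def)

definition locally_good :: "((nat \<Rightarrow> nat) \<Rightarrow> nat \<Rightarrow> nat) \<Rightarrow> bool" where
  "locally_good g \<longleftrightarrow> (\<forall>x\<in>iwords d. \<exists>n. good d H g (pre x n))"

text \<open>Behind a good prefix of length \<open>n\<close> the map acts letter by letter, so
  \<open>k\<close> further common letters of two words yield at least \<open>k\<close> common
  letters of their images.\<close>

lemma locally_good_wcont:
  assumes "locally_good g"
  shows "wcont d g"
  unfolding wcont_def
proof (intro ballI allI impI)
  fix x and e :: real assume x: "x \<in> iwords d" and e: "e > 0"
  obtain n where n: "good d H g (pre x n)" using assms x by (auto simp: locally_good_def)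
  obtain k :: nat where k: "- ln e < real k" using reals_Archimedean2 by blast
  have ek: "exp (- real k) < e" using k e by (metis exp_less_cancel_iff exp_ln minus_less_iff)
  obtain v where v: "v \<in> fwords d" "pre x (n + k) = pre x n @ v" using pre_le[of n "n + k" x] x by auto
  obtain u s where u: "u \<in> fwords d" "s \<in> H" "acts d g (pre x n) u s" using n by (auto simp: good_def)
  have a: "acts d g (pre x (n + k)) (u @ map s v) s"
    using acts_append[OF u(3) v(1)] v by simp
  have lv: "length v = k" using arg_cong[OF v(2), of length] by simp
  have "wdist (g y) (g x) < e" if y: "y \<in> iwords d" "wdist y x < exp (- real (n + k))" for y
  proof -
    have "pre y (n + k) = pre x (n + k)"
      using wdist_less[OF y(2)] by (auto simp: list_eq_iff_nth_eq)
    then have "y \<in> cyl d (pre x (n + k))" "x \<in> cyl d (pre x (n + k))"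
      using x y(1) by (auto simp: mem_cyl_iff)
    then obtain y' x' where "y' \<in> iwords d" "x' \<in> iwords d"
      "y = conc (pre x (n + k)) y'" "x = conc (pre x (n + k)) x'"
      using x by (auto simp: cyl_eq_image)
    then have "g y = conc (u @ map s v) (s \<circ> y')" "g x = conc (u @ map s v) (s \<circ> x')"
      using a unfolding acts_def by metis+
    then have "wdist (g y) (g x) \<le> exp (- real k)"
      using lv by (intro wdist_le) (simp add: conc_def)
    then show ?thesis using ek by simp
  qed
  then show "\<exists>\<delta>>0. \<forall>y\<in>iwords d. wdist y x < \<delta> \<longrightarrow> wdist (g y) (g x) < e"
    by (intro exI[of _ "exp (- real (n + k))"]) simp
qed

text \<open>Extension by the identity makes the map a bijection of the whole function type, so that
  \<open>inv\<close> can take the place of \<open>inv_into\<close>.\<close>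

lemma bij_extension:
  assumes "bij_betw g (iwords d) (iwords d)" "\<And>x. x \<notin> iwords d \<Longrightarrow> g x = x"
  shows "bij g"
proof -
  have "bij_betw g (- iwords d) (- iwords d)"
    using assms(2) by (auto simp: bij_betw_def inj_on_def)
  then have "bij_betw g (iwords d \<union> - iwords d) (iwords d \<union> - iwords d)"
    using assms(1) by (intro bij_betw_combine) auto
  then show ?thesis by simp
qed

lemma locally_good_inv:
  assumes "bij_betw g (iwords d) (iwords d)" "bij g" "locally_good g"
  shows "locally_good (inv g)"
  unfolding locally_good_def
proof
  fix x assume "x \<in> iwords d"
  then obtain z where z: "z \<in> iwords d" "x = g z" using assms(1) by (auto simp: bij_betw_def)
  then obtain n where n: "good d H g (pre z n)" using assms(3) by (auto simp: locally_good_def)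
  obtain u s where u: "u \<in> fwords d" "s \<in> H" "acts d g (pre z n) u s" "g ` cyl d (pre z n) = cyl d u"
    using good_cyl[OF n] z by auto
  then have "x \<in> cyl d u" using z mem_cyl_pre by blast
  then have "pre x (length u) = u" by (simp add: mem_cyl_iff)
  moreover have "good d H (inv g) u" using good_inv[OF assms(2) u(1) _ u(2,3)] z by simp
  ultimately show "\<exists>n. good d H (inv g) (pre x n)" by metis
qed

text \<open>Both continuity conditions are automatic: a locally good map is continuous, and the
  inverse of a locally good bijection is again locally good.\<close>

lemma Vd_iff:
  "g \<in> Vd d H \<longleftrightarrow> bij_betw g (iwords d) (iwords d) \<and> (\<forall>x. x \<notin> iwords d \<longrightarrow> g x = x) \<and> locally_good g"
    (is "_ \<longleftrightarrow> ?b \<and> ?o \<and> _")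
proof -
  let ?L = "\<forall>x \<in> iwords d. \<exists>w1 \<in> fwords d. \<exists>w2 \<in> fwords d. \<exists>\<sigma> \<in> H.
        x \<in> cyl d w1 \<and> (\<forall>y \<in> iwords d. g (conc w1 y) = conc w2 (\<sigma> \<circ> y))"
  have L: "?L \<longleftrightarrow> locally_good g"
    unfolding locally_good_def
  proof (intro ball_cong refl iffI)
    fix x assume "x \<in> iwords d" "\<exists>w1 \<in> fwords d. \<exists>w2 \<in> fwords d. \<exists>\<sigma> \<in> H.
        x \<in> cyl d w1 \<and> (\<forall>y \<in> iwords d. g (conc w1 y) = conc w2 (\<sigma> \<circ> y))"
    then obtain w1 where "x \<in> cyl d w1" "good d H g w1"
      unfolding good_def acts_def by blast
    then show "\<exists>n. good d H g (pre x n)" by (metis mem_cyl_iff)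
  next
    fix x assume x: "x \<in> iwords d" "\<exists>n. good d H g (pre x n)"
    then obtain n where "good d H g (pre x n)" by blast
    then show "\<exists>w1 \<in> fwords d. \<exists>w2 \<in> fwords d. \<exists>\<sigma> \<in> H.
        x \<in> cyl d w1 \<and> (\<forall>y \<in> iwords d. g (conc w1 y) = conc w2 (\<sigma> \<circ> y))"
      unfolding good_def acts_def using x mem_cyl_pre pre_mem by blast
  qed
  have "wcont d (inv_into (iwords d) g)" if g: "?b" "?o" "locally_good g"
  proof -
    have b: "bij g" using g bij_extension by blast
    have "inv_into (iwords d) g x = inv g x" if "x \<in> iwords d" for x
    proof -
      have "x \<in> g ` iwords d" using that g(1) by (simp add: bij_betw_def)
      then have "g (inv_into (iwords d) g x) = x" by (rule f_inv_into_f)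
      then show ?thesis using b by (metis bij_inv_simps(1))
    qed
    moreover have "wcont d (inv g)" using locally_good_wcont locally_good_inv g b by blast
    ultimately show ?thesis by (simp add: wcont_def)
  qed
  then show ?thesis using locally_good_wcont unfolding Vd_def whomeo_def mem_Collect_eq L by blast
qed

lemma VdD:
  assumes "g \<in> Vd d H"
  shows "bij g" "supp_in g (iwords d)" "locally_good g" "g ` iwords d = iwords d"
  using assms bij_extension unfolding Vd_iff by (auto simp: bij_betw_def supp_in_def)

lemma VdI:
  assumes "bij g" "supp_in g (iwords d)" "locally_good g"
  shows "g \<in> Vd d H"
proof -
  have "g ` iwords d \<subseteq> iwords d" "inv g ` iwords d \<subseteq> iwords d"
    using supp_in_image[OF assms(2,1)] supp_in_image[OF supp_in_inv[OF assms(1,2)]] assms(1)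
    by simp_all
  then have "g ` iwords d = iwords d" using assms(1) by (force simp: image_iff)
  then have "bij_betw g (iwords d) (iwords d)"
    using inj_on_subset[OF bij_is_inj[OF assms(1)] subset_UNIV] by (simp add: bij_betw_def)
  then show ?thesis using assms by (simp add: Vd_iff supp_in_def)
qed

text \<open>Composition needs a prefix of \<open>x\<close> whose image word extends a prefix of
  \<open>g x\<close> that is good for \<open>f\<close>. Lengthening a good prefix by
  \<open>k\<close> letters makes the image word at least \<open>k\<close> letters long.\<close>

lemma locally_good_image:
  assumes "g \<in> Vd d H" "f \<in> Vd d H" "x \<in> iwords d"
  obtains n u s where "u \<in> fwords d" "s \<in> H" "acts d g (pre x n) u s" "good d H f u"
proof -
  have gx: "g x \<in> iwords d" using VdD(4)[OF assms(1)] assms(3) by blast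
  obtain m where m: "good d H g (pre x m)" using VdD(3)[OF assms(1)] assms(3) by (auto simp: locally_good_def)
  obtain k where k: "good d H f (pre (g x) k)" using VdD(3)[OF assms(2)] gx by (auto simp: locally_good_def)
  obtain u s where u: "u \<in> fwords d" "s \<in> H" "acts d g (pre x m) u s" using m by (auto simp: good_def)
  obtain v where v: "v \<in> fwords d" "pre x (m + k) = pre x m @ v" using pre_le[of m "m + k" x] assms by auto
  define u' where "u' = u @ map s v"
  have a: "acts d g (pre x (m + k)) u' s" unfolding u'_def v by (rule acts_append[OF u(3) v(1)])
  have u': "u' \<in> fwords d" using u v by (simp add: u'_def)
  have "length v = k" using arg_cong[OF v(2), of length] by simp
  then have len: "k \<le> length u'" by (simp add: u'_def)
  have "g x = conc u' (s \<circ> (\<lambda>i. x (m + k + i)))"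
    using a assms(3) conc_pre[of x "m + k"] unfolding acts_def by (metis shift_mem)
  then have "pre (g x) (length u') = u'" by simp
  then have "good d H f u'" using good_pre_mono[OF k len gx] by simp
  then show ?thesis using that a u' u by blast
qed

lemma perm_group_Vd: "perm_group (Vd d H)"
  unfolding perm_group_def
proof (intro conjI ballI)
  show "id \<in> Vd d H" by (intro VdI) (auto simp: supp_in_def locally_good_def)
  fix f assume f: "f \<in> Vd d H"
  show "bij f" using VdD f by blast
  show "inv f \<in> Vd d H"
    using f VdD[OF f] by (intro VdI supp_in_inv locally_good_inv) (auto simp: Vd_iff)
  fix g assume g: "g \<in> Vd d H"
  have "locally_good (f \<circ> g)"
    unfolding locally_good_def
  proof
    fix x assume x: "x \<in> iwords d"
    obtain n u s where u: "u \<in> fwords d" "s \<in> H" "acts d g (pre x n) u s" "good d H f u"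
      using locally_good_image[OF g f x] .
    obtain t r where t: "t \<in> fwords d" "r \<in> H" "acts d f u t r" using u by (auto simp: good_def)
    have "acts d (f \<circ> g) (pre x n) t (r \<circ> s)"
      using u t by (simp add: acts_def o_assoc)
    then show "\<exists>n. good d H (f \<circ> g) (pre x n)" unfolding good_def using t u H_comp by blast
  qed
  then show "f \<circ> g \<in> Vd d H"
    using VdD[OF f] VdD[OF g] by (intro VdI supp_in_comp) auto
qed

section \<open>Involutions exchanging a set with its image\<close>

definition swap :: "((nat \<Rightarrow> nat) \<Rightarrow> nat \<Rightarrow> nat) \<Rightarrow> (nat \<Rightarrow> nat) set \<Rightarrow> (nat \<Rightarrow> nat) \<Rightarrow> nat \<Rightarrow> nat" where
  "swap f U x = (if x \<in> U then f x else if x \<in> f ` U then inv_into U f x else x)"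

lemma swap_involution:
  assumes "inj_on f U" "f ` U \<inter> U = {}"
  shows "swap f U (swap f U x) = x"
proof -
  consider "x \<in> U" | z where "z \<in> U" "x = f z" | "x \<notin> U" "x \<notin> f ` U" by blast
  then show ?thesis
  proof cases
    case 1
    then have "f x \<in> f ` U" "f x \<notin> U" using assms(2) by auto
    then show ?thesis using 1 assms(1) by (simp add: swap_def)
  next
    case 2
    then have "x \<in> f ` U" "x \<notin> U" using assms(2) by auto
    then show ?thesis using 2 assms(1) by (simp add: swap_def)
  qed (simp add: swap_def)
qed

lemma wopen_image:
  assumes f: "locally_good f" and U: "U \<subseteq> iwords d" "wopen d U" "x \<in> U"
  obtains n u s where "u \<in> fwords d" "s \<in> H" "acts d f (pre x n) u s" "cyl d (pre x n) \<subseteq> U"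
    "cyl d u \<subseteq> f ` U" "f x \<in> cyl d u"
proof -
  have x: "x \<in> iwords d" using U by blast
  obtain m where m: "good d H f (pre x m)" using f x by (auto simp: locally_good_def)
  obtain k where k: "cyl d (pre x k) \<subseteq> U" using U by (auto simp: wopen_def)
  let ?n = "max m k"
  have g: "good d H f (pre x ?n)" using good_pre_mono[OF m _ x] by simp
  have c: "cyl d (pre x ?n) \<subseteq> U" using cyl_pre_anti[of k ?n d x] k by auto
  obtain u s where u: "u \<in> fwords d" "s \<in> H" "acts d f (pre x ?n) u s" "f ` cyl d (pre x ?n) = cyl d u"
    using good_cyl[OF g] x by auto
  have "f x \<in> cyl d u" using u(4) x mem_cyl_pre by blast
  moreover have "cyl d u \<subseteq> f ` U" using u(4) c by blast
  ultimately show ?thesis using that u c by blast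
qed

text \<open>Local goodness is checked separately on \<open>U\<close>, on its image and on the rest,
  each of which is open. Surjectivity of \<open>f\<close> is not assumed, because \<open>f\<close>
  is also taken to be the contraction \<open>conc b\<close>.\<close>

lemma swap_in_Vd:
  assumes f: "locally_good f" "inj_on f (iwords d)" "f ` iwords d \<subseteq> iwords d"
      "wopen d (iwords d - f ` iwords d)"
    and U: "U \<subseteq> iwords d" "wopen d U" "wopen d (iwords d - U)" "f ` U \<inter> U = {}"
  shows "swap f U \<in> Vd d H"
proof (rule VdI)
  have inj: "inj_on f U" using f(2) U(1) inj_on_subset by blast
  have "swap f U \<circ> swap f U = id"
    using swap_involution[OF inj U(4)] by (simp add: fun_eq_iff)
  then show "bij (swap f U)" by (metis o_bij)
  show "supp_in (swap f U) (iwords d)"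
    using U(1) f(3) by (auto simp: supp_in_def swap_def)
  have opn: "wopen d (f ` W)" if W: "W \<subseteq> iwords d" "wopen d W" for W
    unfolding wopen_def
  proof
    fix y assume "y \<in> f ` W"
    then obtain x where x: "x \<in> W" "y = f x" by blast
    obtain n u s where "cyl d u \<subseteq> f ` W" "f x \<in> cyl d u"
      using wopen_image[OF f(1) W x(1)] by metis
    then show "\<exists>n. cyl d (pre y n) \<subseteq> f ` W" using x by (metis mem_cyl_iff)
  qed
  let ?R = "iwords d - U - f ` U"
  have "f ` (iwords d - U) = f ` iwords d - f ` U"
    using f(2) U(1) by (simp add: inj_on_image_set_diff)
  \<comment> \<open>A point outside the image of \<open>U\<close> either misses the range of
    \<open>f\<close> or comes from outside \<open>U\<close>; both are open conditions.\<close>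
  then have "?R = (iwords d - U) \<inter> ((iwords d - f ` iwords d) \<union> f ` (iwords d - U))"
    using f(3) U(1) by blast
  then have R: "wopen d ?R"
    using wopen_Int[OF U(3) wopen_Un[OF f(4) opn[OF _ U(3)]]] by simp
  show "locally_good (swap f U)"
    unfolding locally_good_def
  proof
    fix x assume x: "x \<in> iwords d"
    consider "x \<in> U" | z where "z \<in> U" "x = f z" | "x \<in> ?R" using x by blast
    then show "\<exists>n. good d H (swap f U) (pre x n)"
    proof cases
      case 1
      obtain n u s where u: "u \<in> fwords d" "s \<in> H" "acts d f (pre x n) u s" "cyl d (pre x n) \<subseteq> U"
        using wopen_image[OF f(1) U(1,2) 1] by metis
      have "good d H f (pre x n)" using u by (auto simp: good_def)
      moreover have "swap f U y = f y" if "y \<in> cyl d (pre x n)" for y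
        using that u(4) by (auto simp: swap_def)
      ultimately show ?thesis using good_cong x by (metis pre_mem)
    next
      case 2
      obtain n u s where u: "u \<in> fwords d" "s \<in> H" "acts d f (pre z n) u s" "cyl d (pre z n) \<subseteq> U"
        "f z \<in> cyl d u"
        using wopen_image[OF f(1) U(1,2) 2(1)] by metis
      have z: "z \<in> iwords d" using 2 U by blast
      have "acts d (swap f U) u (pre z n) (inv s)"
        unfolding acts_def
      proof
        fix y assume y: "y \<in> iwords d"
        let ?p = "conc (pre z n) (inv s \<circ> y)"
        have "?p \<in> U" using u(2,4) y z H_inv by (auto intro!: subsetD[OF u(4)])
        moreover have "f ?p = conc u y" using u y H_inv by (simp add: acts_def)
        ultimately have "swap f U ?p = conc u y" by (simp add: swap_def)
        then show "swap f U (conc u y) = ?p"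
          using swap_involution[OF inj U(4)] by metis
      qed
      then have "good d H (swap f U) u" unfolding good_def using u H_inv z by (meson pre_mem)
      moreover have "pre x (length u) = u" using u(5) 2(2) by (simp add: mem_cyl_iff)
      ultimately show ?thesis by metis
    next
      case 3
      then obtain n where n: "cyl d (pre x n) \<subseteq> ?R" using R unfolding wopen_def by blast
      have "swap f U y = id y" if "y \<in> cyl d (pre x n)" for y
        using that n by (auto simp: swap_def)
      then show ?thesis using good_cong[of "pre x n" "swap f U" id] x by auto
    qed
  qed
qed

lemma supp_swap: "supp_in (swap f U) (U \<union> f ` U)"
  by (simp add: supp_in_def swap_def)

text \<open>Prefixing \<open>b\<close> contracts the whole space into one ball, so a clopen set
  disjoint from that ball can be exchanged with a small copy of itself there.\<close>

lemma swap_conc_in_Vd: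
  assumes "b \<in> fwords d" "U \<subseteq> iwords d" "wopen d U" "wopen d (iwords d - U)" "cyl d b \<inter> U = {}"
  shows "swap (conc b) U \<in> Vd d H" "swap (conc b) U ` U \<subseteq> cyl d b"
    "supp_in (swap (conc b) U) (U \<union> cyl d b)"
proof -
  have im: "conc b ` U \<subseteq> cyl d b" using assms by auto
  have "locally_good (conc b)"
    unfolding locally_good_def
  proof
    fix x assume "x \<in> iwords d"
    have "acts d (conc b) [] b id" by (simp add: acts_def)
    then have "good d H (conc b) (pre x 0)"
      unfolding good_def pre_def using assms H_id by auto
    then show "\<exists>n. good d H (conc b) (pre x n)" by blast
  qed
  moreover have "wopen d (iwords d - conc b ` iwords d)"
    using wopen_Compl_cyl[of d b] assms by (simp add: cyl_eq_image)
  ultimately show "swap (conc b) U \<in> Vd d H"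
    using assms im by (intro swap_in_Vd) (auto simp: inj_on_def)
  show "swap (conc b) U ` U \<subseteq> cyl d b" using im by (auto simp: swap_def)
  show "supp_in (swap (conc b) U) (U \<union> cyl d b)"
    using im by (intro supp_in_mono[OF supp_swap]) blast
qed

lemma cyl_nonempty: "w \<in> fwords d \<Longrightarrow> cyl d w \<noteq> {}"
  using cyl_eq_image const_mem by blast

lemma cyl_disjoint:
  assumes "a \<noteq> b"
  shows "cyl d (w @ a # u) \<inter> cyl d (w @ b # v) = {}"
proof -
  have "x (length w) = a" if "x \<in> cyl d (w @ a # u)" for x a u
    using that by (auto simp: cyl_def nth_append dest!: spec[of _ "length w"])
  then show ?thesis using assms by blast
qed

text \<open>By continuity, all words near \<open>x\<close> have images with the letter of
  \<open>g x\<close> at a position \<open>i\<close> where it differs from that of \<open>x\<close>.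
  A prefix reaching beyond \<open>i\<close> then defines a displaced ball.\<close>

lemma Vd_displace:
  assumes g: "g \<in> Vd d H" "g \<noteq> id"
  obtains w where "w \<in> fwords d" "g ` cyl d w \<inter> cyl d w = {}"
proof -
  obtain x where ne: "g x \<noteq> x" using g(2) by (auto simp: fun_eq_iff)
  then have x: "x \<in> iwords d" using VdD(2)[OF g(1)] by (auto simp: supp_in_def)
  obtain i where i: "g x i \<noteq> x i" using ne by (auto simp: fun_eq_iff)
  have gx: "g x \<in> iwords d" using VdD(4)[OF g(1)] x by blast
  have c: "g x \<in> cyl d (pre (g x) (Suc i))" using gx by simp
  have "locally_good g" using VdD g by blast
  then have "wcont d g" by (rule locally_good_wcont)
  then obtain \<delta> where \<delta>: "\<delta> > 0" "\<And>y. y \<in> iwords d \<Longrightarrow> wdist y x < \<delta> \<Longrightarrow> wdist (g y) (g x) < exp (- real i)"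
    unfolding wcont_def using x by (metis exp_gt_zero)
  obtain k :: nat where k: "- ln \<delta> < real k" using reals_Archimedean2 by blast
  have ek: "exp (- real k) < \<delta>" using k \<delta>(1) by (metis exp_less_cancel_iff exp_ln minus_less_iff)
  let ?w = "pre x (max k (Suc i))"
  have w: "y j = x j" if "y \<in> cyl d ?w" "j < max k (Suc i)" for y j
    using that by (auto simp: cyl_def)
  have "g y \<notin> cyl d ?w" if y: "y \<in> cyl d ?w" for y
  proof
    assume "g y \<in> cyl d ?w"
    then have "g y i = x i" using w by simp
    moreover have "wdist y x \<le> exp (- real k)" using w[OF y] by (intro wdist_le) auto
    then have "g y i = g x i"
      using \<delta>(2)[of y] ek y by (intro wdist_less[of "g y" "g x" i]) (auto simp: mem_cyl_iff)
    ultimately show False using i by simp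
  qed
  then show ?thesis using that[of ?w] x by auto
qed

lemma Vd_swap:
  assumes g: "g \<in> Vd d H" and w: "g ` cyl d w \<inter> cyl d w = {}"
  shows "swap g (cyl d w) \<in> Vd d H"
proof (rule swap_in_Vd)
  show "inj_on g (iwords d)" using bij_is_inj[OF VdD(1)[OF g]] inj_on_subset by blast
  show "wopen d (iwords d - g ` iwords d)" using VdD(4)[OF g] by (simp add: wopen_def)
qed (use VdD[OF g] w wopen_cyl wopen_Compl_cyl in \<open>auto simp: mem_cyl_iff\<close>)

text \<open>If the two balls meet, the complement of \<open>cyl d w\<close> is exchanged with a copy
  inside both. If they are disjoint, the target lies within that complement and no direct exchange
  is available; the complement is parked in a sub-ball of \<open>cyl d w\<close>, and this sub-ball
  is exchanged with a part of the target.\<close>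

lemma Vd_compress:
  assumes w: "w \<in> fwords d" and b: "b \<in> fwords d"
  obtains c z where "c \<in> Vd d H" "z \<in> fwords d" "cyl d z \<subseteq> cyl d w"
    "c ` (iwords d - cyl d w) \<subseteq> cyl d b" "supp_in c (iwords d - cyl d z)"
proof -
  let ?U = "iwords d - cyl d w"
  have U: "?U \<subseteq> iwords d" "wopen d ?U" "wopen d (iwords d - ?U)"
    using wopen_Compl_cyl wopen_cyl[of d w] by (auto simp: double_diff mem_cyl_iff Diff_Diff_Int Int_absorb1 subset_iff)
  show ?thesis
  proof (cases "cyl d w \<inter> cyl d b = {}")
    case False
    then obtain x where x: "x \<in> cyl d w" "x \<in> cyl d b" by blast
    then have xi: "x \<in> iwords d" by (simp add: mem_cyl_iff)
    \<comment> \<open>Strictly longer than both words, so that the prefix has a letter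
      \<open>a\<close> right after \<open>w\<close>; a different letter \<open>a'\<close> there
      gives the fixed ball.\<close>
    define m where "m = Suc (max (length w) (length b))"
    have "pre x (length w) = w" using x by (simp add: mem_cyl_iff)
    then obtain v where v: "pre x m = w @ v" "v \<in> fwords d"
      using pre_le[of "length w" m x d] xi unfolding m_def by (metis le_SucI max.cobounded1)
    have "v \<noteq> []" using arg_cong[OF v(1), of length] by (auto simp: m_def)
    then obtain a v' where a: "v = a # v'" by (cases v) auto
    have pb: "cyl d (pre x m) \<subseteq> cyl d b"
      using x cyl_pre_anti[of "length b" m d x] by (auto simp: m_def mem_cyl_iff)
    have pw: "cyl d (pre x m) \<subseteq> cyl d w" using v cyl_append by simp
    define a' :: nat where "a' = (if a = 1 then 2 else 1)"
    have a': "a' \<in> {1..d}" "a' \<noteq> a" using d by (auto simp: a'_def)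
    let ?z = "w @ [a']"
    have zm: "cyl d ?z \<inter> cyl d (pre x m) = {}" using cyl_disjoint[OF a'(2)] v a by auto
    have zw: "cyl d ?z \<subseteq> cyl d w" by (rule cyl_append)
    have "pre x m \<in> fwords d" "cyl d (pre x m) \<inter> ?U = {}" using xi pw by auto
    note s = swap_conc_in_Vd[OF this(1) U this(2)]
    show ?thesis
    proof (rule that)
      show "swap (conc (pre x m)) ?U \<in> Vd d H" by (rule s)
      show "swap (conc (pre x m)) ?U ` ?U \<subseteq> cyl d b" by (rule subset_trans[OF s(2) pb])
      show "supp_in (swap (conc (pre x m)) ?U) (iwords d - cyl d ?z)"
        by (rule supp_in_mono[OF s(3)]) (use zm zw in \<open>auto simp: mem_cyl_iff\<close>)
      show "?z \<in> fwords d" using w a' by simp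
    qed (rule zw)
  next
    case True
    let ?y = "w @ [1]" and ?z = "w @ [2]"
    have yz: "?y \<in> fwords d" "?z \<in> fwords d" using w d by auto
    have sub: "cyl d ?y \<subseteq> cyl d w" "cyl d ?z \<subseteq> cyl d w" by (rule cyl_append)+
    have dis: "cyl d ?y \<inter> cyl d ?z = {}" by (rule cyl_disjoint) simp
    note s = swap_conc_in_Vd[OF yz(1) U]
    have sub': "cyl d ?y \<subseteq> iwords d" by (auto simp: mem_cyl_iff)
    note t = swap_conc_in_Vd[OF b sub' wopen_cyl wopen_Compl_cyl]
    let ?s = "swap (conc ?y) ?U" and ?t = "swap (conc b) (cyl d ?y)"
    have bY: "cyl d b \<inter> cyl d ?y = {}" using True sub by blast
    have yU: "cyl d ?y \<inter> ?U = {}" using sub by blast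
    show ?thesis
    proof (rule that)
      show "?t \<circ> ?s \<in> Vd d H" using s(1) t(1) yU bY perm_groupD(4)[OF perm_group_Vd] by blast
      show "(?t \<circ> ?s) ` ?U \<subseteq> cyl d b" using s(2)[OF yU] t(2)[OF bY] by (auto simp: image_comp[symmetric])
      have "supp_in ?s (iwords d - cyl d ?z)"
        using s(3)[OF yU] by (rule supp_in_mono) (use dis sub in \<open>auto simp: mem_cyl_iff\<close>)
      moreover have "supp_in ?t (iwords d - cyl d ?z)"
        using t(3)[OF bY] by (rule supp_in_mono) (use dis sub True in \<open>auto simp: mem_cyl_iff\<close>)
      ultimately show "supp_in (?t \<circ> ?s) (iwords d - cyl d ?z)" by (intro supp_in_comp)
      show "?z \<in> fwords d" by (rule yz)
    qed (rule sub)
  qed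
qed

lemma ball_group_Vd: "ball_group (iwords d) (cyl d ` fwords d) (Vd d H)"
proof
  fix B assume "B \<in> cyl d ` fwords d"
  then obtain w where w: "w \<in> fwords d" "B = cyl d w" by blast
  show "B \<subseteq> iwords d \<and> B \<noteq> {}" using w cyl_nonempty by (auto simp: mem_cyl_iff)
  have "cyl d (w @ [1]) \<inter> cyl d (w @ [2]) = {}" by (rule cyl_disjoint) simp
  moreover have "w @ [1] \<in> fwords d" "w @ [2] \<in> fwords d" using w d by auto
  ultimately show "\<exists>B1\<in>cyl d ` fwords d. \<exists>B2\<in>cyl d ` fwords d. B1 \<subseteq> B \<and> B2 \<subseteq> B \<and> B1 \<inter> B2 = {}"
    unfolding w(2) using cyl_append by (intro bexI[OF _ imageI] conjI) assumption+
  fix g assume g: "g \<in> Vd d H"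
  obtain x where x: "x \<in> B" using w cyl_nonempty by blast
  have "B \<subseteq> iwords d" "wopen d B" using w wopen_cyl by (auto simp: mem_cyl_iff)
  then obtain u where "u \<in> fwords d" "cyl d u \<subseteq> g ` B"
    using wopen_image[OF VdD(3)[OF g] _ _ x] by blast
  then show "\<exists>B'\<in>cyl d ` fwords d. B' \<subseteq> g ` B" by blast
  assume "g ` B \<inter> B = {}"
  then have "swap g B \<in> Vd d H" using Vd_swap g w by blast
  moreover have "\<forall>x\<in>B. swap g B x = g x" by (simp add: swap_def)
  ultimately show "\<exists>s\<in>Vd d H. (\<forall>x\<in>B. s x = g x) \<and> supp_in s (B \<union> g ` B)"
    using supp_swap by blast
next
  fix Y B assume Y: "Y \<in> cyl d ` fwords d" and B: "B \<in> cyl d ` fwords d"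
  obtain w where w: "w \<in> fwords d" "Y = cyl d w" using Y by blast
  obtain b where b: "b \<in> fwords d" "B = cyl d b" using B by blast
  obtain c z where "c \<in> Vd d H" "z \<in> fwords d" "cyl d z \<subseteq> cyl d w"
    "c ` (iwords d - cyl d w) \<subseteq> cyl d b" "supp_in c (iwords d - cyl d z)"
    using Vd_compress[OF w(1) b(1)] .
  then show "\<exists>c\<in>Vd d H. \<exists>Z\<in>cyl d ` fwords d.
      Z \<subseteq> Y \<and> c ` (iwords d - Y) \<subseteq> B \<and> supp_in c (iwords d - Z)"
    unfolding w(2) b(2) by (intro bexI[of _ c] bexI[OF _ imageI[of z]] conjI)
next
  fix g assume "g \<in> Vd d H" "g \<noteq> id"
  then obtain w where "w \<in> fwords d" "g ` cyl d w \<inter> cyl d w = {}" using Vd_displace by metis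
  then show "\<exists>W\<in>cyl d ` fwords d. g ` W \<inter> W = {}" by (intro bexI[OF _ imageI])
next
  show "cyl d ` fwords d \<noteq> {}" using fwords_Nil by blast
qed (simp_all add: perm_group_Vd VdD)

end

section \<open>Parity\<close>

text \<open>The set \<open>T\<close> need not be invariant under \<open>g\<close>: a letterwise
  permutation, for instance, may change the tails of the sample points used below.\<close>

definition inversions :: "('a \<Rightarrow> 'a \<Rightarrow> bool) \<Rightarrow> ('a \<Rightarrow> 'a) \<Rightarrow> 'a set \<Rightarrow> ('a \<times> 'a) set" where
  "inversions lt g T = {(x, y). x \<in> T \<and> y \<in> T \<and> lt x y \<and> lt (g y) (g x)}"

lemma finite_inversions [simp]: "finite T \<Longrightarrow> finite (inversions lt g T)"
  by (rule finite_subset[of _ "T \<times> T"]) (auto simp: inversions_def)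

text \<open>The pairs in \<open>A\<close> are reversed by \<open>f\<close> only, those in
  \<open>B\<close> by both maps, those in \<open>C\<close> by \<open>g\<close> only. The three
  inversion counts are \<open>A + C\<close>, \<open>A + B\<close> and \<open>B + C\<close> in
  cardinalities, and their sum is even.\<close>

lemma even_card_inversions_comp:
  assumes asym: "\<And>x y. lt x y \<Longrightarrow> \<not> lt y x" and total: "\<And>x y. x \<noteq> y \<Longrightarrow> lt x y \<or> lt y x"
    and T: "finite T" "inj_on g T" "inj_on f (g ` T)"
  shows "even (card (inversions lt (f \<circ> g) T)) \<longleftrightarrow>
    (even (card (inversions lt f (g ` T))) = even (card (inversions lt g T)))"
proof -
  define A where "A = {(x, y). x \<in> T \<and> y \<in> T \<and> lt x y \<and> lt (g x) (g y) \<and> lt (f (g y)) (f (g x))}"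
  define B where "B = {(x, y). x \<in> T \<and> y \<in> T \<and> lt x y \<and> lt (g y) (g x) \<and> lt (f (g x)) (f (g y))}"
  define C where "C = {(x, y). x \<in> T \<and> y \<in> T \<and> lt x y \<and> lt (g y) (g x) \<and> lt (f (g y)) (f (g x))}"
  have fin: "finite A" "finite B" "finite C"
    by (rule finite_subset[of _ "T \<times> T"]; use T in \<open>auto simp: A_def B_def C_def\<close>)+
  have irr: "\<not> lt x x" for x using asym by blast
  have gne: "g x \<noteq> g y" "f (g x) \<noteq> f (g y)" if "x \<in> T" "y \<in> T" "lt x y" for x y
    using that T(2,3) irr by (metis inj_onD, metis imageI inj_onD)
  have "inversions lt (f \<circ> g) T = A \<union> C"
    using total gne by (force simp: inversions_def A_def C_def)
  moreover have "A \<inter> C = {}" using asym by (auto simp: A_def C_def)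
  ultimately have 1: "card (inversions lt (f \<circ> g) T) = card A + card C"
    using fin by (simp add: card_Un_disjoint)
  have "inversions lt g T = B \<union> C"
    using total gne by (force simp: inversions_def B_def C_def)
  moreover have "B \<inter> C = {}" using asym by (auto simp: B_def C_def)
  ultimately have 2: "card (inversions lt g T) = card B + card C"
    using fin by (simp add: card_Un_disjoint)
  \<comment> \<open>Since \<open>g\<close> reverses the pairs in \<open>B\<close>, their images
    become inversions of \<open>f\<close> only when listed in the opposite order.\<close>
  let ?a = "\<lambda>(x, y). (g x, g y)" and ?b = "\<lambda>(x, y). (g y, g x)"
  have "inversions lt f (g ` T) \<subseteq> ?a ` A \<union> ?b ` B"
  proof
    fix p assume "p \<in> inversions lt f (g ` T)"
    then obtain x y where p: "p = (g x, g y)" "x \<in> T" "y \<in> T" "lt (g x) (g y)" "lt (f (g y)) (f (g x))"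
      by (auto simp: inversions_def)
    then have "x \<noteq> y" using irr by blast
    then consider "lt x y" | "lt y x" using total by blast
    then show "p \<in> ?a ` A \<union> ?b ` B"
    proof cases
      case 1
      then have "(x, y) \<in> A" using p by (simp add: A_def)
      then show ?thesis using p(1) by force
    next
      case 2
      then have "(y, x) \<in> B" using p by (simp add: B_def)
      then show ?thesis using p(1) by force
    qed
  qed
  moreover have "?a ` A \<union> ?b ` B \<subseteq> inversions lt f (g ` T)"
    by (auto simp: A_def B_def inversions_def)
  ultimately have e: "inversions lt f (g ` T) = ?a ` A \<union> ?b ` B" by blast
  have "?a ` A \<inter> ?b ` B = {}"
  proof (rule ccontr)
    assume "?a ` A \<inter> ?b ` B \<noteq> {}"
    then obtain x y x' y' where xy: "(x, y) \<in> A" "(x', y') \<in> B" "g x = g y'" "g y = g x'" by auto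
    then have "x = y'" "y = x'" using T(2) unfolding A_def B_def by (auto dest: inj_onD)
    then show False using xy asym by (auto simp: A_def B_def)
  qed
  moreover have "inj_on ?a A" "inj_on ?b B"
    using T(2) by (auto simp: inj_on_def A_def B_def)
  ultimately have 3: "card (inversions lt f (g ` T)) = card A + card B"
    unfolding e using fin by (simp add: card_Un_disjoint card_image)
  show ?thesis unfolding 1 2 3 by auto
qed

text \<open>For \<open>a < b\<close>, every \<open>c\<close> strictly between them lies in exactly
  two inversions, \<open>(a, c)\<close> and \<open>(c, b)\<close>; the pair \<open>(a, b)\<close> is
  the odd one left over.\<close>

lemma odd_card_inversions_transpose:
  fixes a b :: nat
  assumes "finite S" "a \<in> S" "b \<in> S" "a \<noteq> b"
  shows "odd (card (inversions (<) (transpose a b) S))"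
proof -
  have *: "odd (card (inversions (<) (transpose a b) S))" if ab: "a \<in> S" "b \<in> S" "a < b" for a b :: nat
  proof -
    define C where "C = {c \<in> S. a < c \<and> c < b}"
    have fin: "finite C" using assms(1) by (simp add: C_def)
    have "inversions (<) (transpose a b) S = insert (a, b) (Pair a ` C \<union> (\<lambda>c. (c, b)) ` C)"
      using ab by (auto simp: inversions_def C_def transpose_def split: if_splits)
    also have "card \<dots> = Suc (card (Pair a ` C \<union> (\<lambda>c. (c, b)) ` C))"
      using fin by (subst card_insert_disjoint) (auto simp: C_def)
    also have "card (Pair a ` C \<union> (\<lambda>c. (c, b)) ` C) = card C + card C"
      using fin by (subst card_Un_disjoint) (auto simp: C_def card_image inj_on_def)
    finally show ?thesis by simp
  qed
  show ?thesis
  proof (cases "a < b")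
    case False
    then have "b < a" using assms by simp
    then show ?thesis using *[of b a] assms by (simp add: transpose_commute)
  qed (use * assms in auto)
qed

lemma evenperm_iff_inversions:
  fixes p :: "nat \<Rightarrow> nat"
  assumes "p permutes S" "finite S"
  shows "evenperm p \<longleftrightarrow> even (card (inversions (<) p S))"
  using assms
proof (induction rule: permutes_induct)
  case id
  have "inversions (<) (\<lambda>x :: nat. x) S = {}" by (auto simp: inversions_def)
  then show ?case using evenperm_id by (simp add: id_def)
next
  case (swap a b p)
  have "evenperm (transpose a b \<circ> p) \<longleftrightarrow> \<not> evenperm p"
  proof -
    have "permutation p" using swap assms(2) permutation_permutes by blast
    then show ?thesis using swap by (simp add: evenperm_comp permutation_swap_id evenperm_swap)
  qed
  moreover have "even (card (inversions (<) (transpose a b \<circ> p) S)) \<longleftrightarrow> \<not> even (card (inversions (<) p S))"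
  proof -
    have "transpose a b permutes S" using swap by (simp add: permutes_swap_id)
    then have "even (card (inversions (<) (transpose a b \<circ> p) S)) \<longleftrightarrow>
      (even (card (inversions (<) (transpose a b) (p ` S))) = even (card (inversions (<) p S)))"
      using swap assms(2) by (intro even_card_inversions_comp) (auto intro: permutes_inj_on)
    then show ?thesis
      using odd_card_inversions_transpose[of S a b] swap assms(2) by (simp add: permutes_image)
  qed
  ultimately show ?case using swap by blast
qed

text \<open>Two different blocks contribute either nothing or all of their product, which has odd
  size, so each related pair of blocks counts as one modulo 2. Pairs within one block contribute an
  even number.\<close>

lemma even_card_blocks:
  assumes fin: "finite I" "\<And>i. i \<in> I \<Longrightarrow> finite (B i)"
    and disj: "\<And>i j. i \<in> I \<Longrightarrow> j \<in> I \<Longrightarrow> i \<noteq> j \<Longrightarrow> B i \<inter> B j = {}"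
    and odd: "\<And>i. i \<in> I \<Longrightarrow> odd (card (B i))"
    and within: "\<And>i. i \<in> I \<Longrightarrow> even (card {(x, y). x \<in> B i \<and> y \<in> B i \<and> R x y})"
    and between: "\<And>i j x y. i \<in> I \<Longrightarrow> j \<in> I \<Longrightarrow> i \<noteq> j \<Longrightarrow> x \<in> B i \<Longrightarrow> y \<in> B j \<Longrightarrow> R x y \<longleftrightarrow> S i j"
    and irrefl: "\<And>i. i \<in> I \<Longrightarrow> \<not> S i i"
  shows "even (card {(x, y). x \<in> \<Union>(B ` I) \<and> y \<in> \<Union>(B ` I) \<and> R x y}) \<longleftrightarrow>
    even (card {(i, j). i \<in> I \<and> j \<in> I \<and> S i j})"
proof -
  let ?D = "\<lambda>(i, j). {(x, y). x \<in> B i \<and> y \<in> B j \<and> R x y}"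
  have finD: "finite (?D p)" if "p \<in> I \<times> I" for p
    using that fin by (auto intro: finite_subset[of _ "B (fst p) \<times> B (snd p)"])
  have "{(x, y). x \<in> \<Union>(B ` I) \<and> y \<in> \<Union>(B ` I) \<and> R x y} = (\<Union>p\<in>I \<times> I. ?D p)" by auto
  also have "card \<dots> = (\<Sum>p\<in>I \<times> I. card (?D p))"
  proof (rule card_UN_disjoint)
    show "\<forall>p\<in>I \<times> I. \<forall>q\<in>I \<times> I. p \<noteq> q \<longrightarrow> ?D p \<inter> ?D q = {}"
      using disj by auto
  qed (use fin finD in auto)
  finally have "even (card {(x, y). x \<in> \<Union>(B ` I) \<and> y \<in> \<Union>(B ` I) \<and> R x y}) \<longleftrightarrow>
      even (card {p \<in> I \<times> I. odd (card (?D p))})"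
    using fin by (simp add: even_sum_iff)
  also have "{p \<in> I \<times> I. odd (card (?D p))} = {(i, j). i \<in> I \<and> j \<in> I \<and> S i j}"
  proof -
    have "odd (card (?D (i, j))) \<longleftrightarrow> S i j" if ij: "i \<in> I" "j \<in> I" for i j
    proof (cases "i = j")
      case True
      then show ?thesis using within irrefl ij by simp
    next
      case False
      then have "?D (i, j) = (if S i j then B i \<times> B j else {})"
        using between[OF ij False] by auto
      then show ?thesis using odd ij by (simp add: card_cartesian_product)
    qed
    then show ?thesis by auto
  qed
  finally show ?thesis .
qed

section \<open>Lexicographic order on infinite words and sample points\<close>

definition wless :: "(nat \<Rightarrow> nat) \<Rightarrow> (nat \<Rightarrow> nat) \<Rightarrow> bool" where
  "wless x y \<longleftrightarrow> (\<exists>n. x n < y n \<and> (\<forall>i<n. x i = y i))"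

lemma wless_first:
  assumes "\<And>i. i < n \<Longrightarrow> x i = y i" "x n \<noteq> y n"
  shows "wless x y \<longleftrightarrow> x n < y n"
proof
  assume "wless x y"
  then obtain m where m: "x m < y m" "\<forall>i<m. x i = y i" by (auto simp: wless_def)
  have "m = n" using m assms by (metis linorder_neqE_nat nat_neq_iff)
  then show "x n < y n" using m by simp
qed (use assms in \<open>auto simp: wless_def\<close>)

lemma first_diff:
  fixes x y :: "nat \<Rightarrow> nat"
  assumes "x \<noteq> y"
  obtains n where "\<And>i. i < n \<Longrightarrow> x i = y i" "x n \<noteq> y n"
proof -
  have "\<exists>n. x n \<noteq> y n" using assms by auto
  then show ?thesis
    using that[of "LEAST n. x n \<noteq> y n"] LeastI_ex[of "\<lambda>n. x n \<noteq> y n"] not_less_Least[of _ "\<lambda>n. x n \<noteq> y n"]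
    by blast
qed

lemma wless_total: "x \<noteq> y \<Longrightarrow> wless x y \<or> wless y x"
  by (metis first_diff linorder_neqE_nat wless_first)

lemma wless_asym: "wless x y \<Longrightarrow> \<not> wless y x"
proof
  assume "wless x y" "wless y x"
  then obtain n m where "x n < y n" "\<forall>i<n. x i = y i" "y m < x m" "\<forall>i<m. y i = x i"
    unfolding wless_def by blast
  then show False by (cases n m rule: linorder_cases) auto
qed

lemma wless_conc [simp]: "wless (conc w x) (conc w y) \<longleftrightarrow> wless x y"
proof (cases "x = y")
  case True
  then show ?thesis using wless_asym by auto
next
  case False
  then obtain n where n: "\<And>i. i < n \<Longrightarrow> x i = y i" "x n \<noteq> y n" using first_diff by blast
  have "wless (conc w x) (conc w y) \<longleftrightarrow> conc w x (length w + n) < conc w y (length w + n)"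
    using n by (intro wless_first) (auto simp: conc_def)
  then show ?thesis using wless_first[of n x y] n by (simp add: conc_add)
qed

text \<open>The first difference of \<open>x\<close> and \<open>y\<close> lies within both words,
  since otherwise one point would belong to both cylinders. Hence the order between two disjoint
  cylinders depends on their words alone.\<close>

lemma wless_cyl:
  assumes "cyl d u \<inter> cyl d v = {}" "x \<in> cyl d u" "y \<in> cyl d v"
  obtains n where "n < length u" "n < length v" "u ! n \<noteq> v ! n" "\<And>i. i < n \<Longrightarrow> u ! i = v ! i"
proof -
  have "x \<noteq> y" using assms by blast
  then obtain n where n: "\<And>i. i < n \<Longrightarrow> x i = y i" "x n \<noteq> y n" using first_diff by blast
  have nu: "n < length u"
  proof (rule ccontr)
    assume "\<not> n < length u"
    then have "y \<in> cyl d u" using assms n by (auto simp: cyl_def)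
    then show False using assms by blast
  qed
  have nv: "n < length v"
  proof (rule ccontr)
    assume "\<not> n < length v"
    then have "x \<in> cyl d v" using assms n(1)[symmetric] by (auto simp: cyl_def)
    then show False using assms by blast
  qed
  have "u ! i = x i" "v ! i = y i" if "i \<le> n" for i
    using that nu nv assms by (auto simp: cyl_def)
  then show ?thesis using that nu nv n by (metis order_less_imp_le order_refl)
qed

lemma wless_cyl_cong:
  assumes "cyl d u \<inter> cyl d v = {}" "x \<in> cyl d u" "x' \<in> cyl d u" "y \<in> cyl d v" "y' \<in> cyl d v"
  shows "wless x y \<longleftrightarrow> wless x' y'"
proof -
  obtain n where n: "n < length u" "n < length v" "u ! n \<noteq> v ! n" "\<And>i. i < n \<Longrightarrow> u ! i = v ! i"
    using wless_cyl[OF assms(1,2,4)] by blast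
  have "wless x y \<longleftrightarrow> u ! n < v ! n" if "x \<in> cyl d u" "y \<in> cyl d v" for x y
  proof -
    have "x i = u ! i" "y i = v ! i" if "i \<le> n" for i
      using that \<open>x \<in> cyl d u\<close> \<open>y \<in> cyl d v\<close> n by (auto simp: cyl_def)
    then show ?thesis using n by (subst wless_first[of n]) auto
  qed
  then show ?thesis using assms by simp
qed

text \<open>Neither word is a prefix of the other, so the order on finite words is decided by a
  letter that all points of the cylinders share.\<close>

lemma lexless_imp_wless:
  assumes "lexless u v" "cyl d u \<inter> cyl d v = {}" "x \<in> cyl d u" "y \<in> cyl d v"
  shows "wless x y"
proof -
  obtain n where n: "n < length u" "n < length v" "u ! n \<noteq> v ! n" "\<And>i. i < n \<Longrightarrow> u ! i = v ! i"
    using wless_cyl[OF assms(2-4)] by blast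
  have "u ! n < v ! n"
  proof (rule ccontr)
    assume "\<not> u ! n < v ! n"
    then have "v ! n < u ! n" using n by simp
    moreover have "take n u = take n v" using n by (simp add: list_eq_iff_nth_eq)
    ultimately have "(v, u) \<in> lexord {(a, b). a < b}"
      unfolding lexord_take_index_conv using n by (intro CollectI case_prodI disjI2 exI[of _ n]) auto
    then show False using assms(1) unfolding lexless_def
      by (metis (mono_tags, lifting) list_less_def less_asym)
  qed
  moreover have "x i = u ! i" "y i = v ! i" if "i \<le> n" for i
    using that assms n by (auto simp: cyl_def)
  ultimately show ?thesis using n unfolding wless_def by (intro exI[of _ n]) auto
qed

text \<open>A finite sample with one point for each word of length \<open>N\<close> over the
  alphabet. The tail letter 1 belongs to the alphabet for every admissible \<open>d\<close>.\<close>

definition pts :: "nat \<Rightarrow> nat \<Rightarrow> (nat \<Rightarrow> nat) set" where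
  "pts d N = {x \<in> iwords d. \<forall>i\<ge>N. x i = 1}"

context words
begin

lemmas const_mem_Suc [simp] = const_mem[unfolded One_nat_def]

lemma pts_Int_cyl:
  assumes "v \<in> fwords d" "length v \<le> N"
  shows "pts d N \<inter> cyl d v = conc v ` pts d (N - length v)"
proof (intro Set.set_eqI iffI)
  fix x assume x: "x \<in> pts d N \<inter> cyl d v"
  then obtain y where y: "y \<in> iwords d" "x = conc v y" using assms by (auto simp: cyl_eq_image)
  have "y i = 1" if "i \<ge> N - length v" for i
  proof -
    have "x (length v + i) = 1" using x that by (auto simp: pts_def)
    then show ?thesis using y by (simp add: conc_add)
  qed
  then show "x \<in> conc v ` pts d (N - length v)" using y by (auto simp: pts_def)
next
  fix x assume "x \<in> conc v ` pts d (N - length v)"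
  then obtain y where y: "x = conc v y" "y \<in> iwords d" "\<And>i. i \<ge> N - length v \<Longrightarrow> y i = 1"
    by (auto simp: pts_def)
  have "x i = 1" if "i \<ge> N" for i using y(3)[of "i - length v"] assms(2) that by (simp add: y(1) conc_def)
  then show "x \<in> pts d N \<inter> cyl d v" using y assms by (simp add: pts_def)
qed

lemma pts_0: "pts d 0 = {\<lambda>_. 1}"
  using d by (auto simp: pts_def iwords_def)

lemma pts_Suc: "pts d (Suc k) = (\<Union>a\<in>{1..d}. conc [a] ` pts d k)"
proof -
  have "pts d (Suc k) = (\<Union>a\<in>{1..d}. pts d (Suc k) \<inter> cyl d [a])"
    by (auto simp: pts_def iwords_def cyl_def)
  also have "\<dots> = (\<Union>a\<in>{1..d}. conc [a] ` pts d k)"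
    by (intro SUP_cong refl) (simp add: pts_Int_cyl)
  finally show ?thesis .
qed

lemma finite_pts [simp]: "finite (pts d k)"
  by (induction k) (simp_all only: pts_0 pts_Suc finite_UN finite_imageI finite_insert finite.emptyI finite_atLeastAtMost, simp)

lemma conc_Cons_disjoint: "a \<noteq> b \<Longrightarrow> conc [a] ` S \<inter> conc [b] ` T = {}"
  by (auto simp: conc_eq_append_iff)

lemma card_pts: "card (pts d k) = d ^ k"
proof (induction k)
  case (Suc k)
  have "card (pts d (Suc k)) = (\<Sum>a\<in>{1..d}. card (conc [a] ` pts d k))"
    unfolding pts_Suc using conc_Cons_disjoint by (intro card_UN_disjoint) auto
  also have "\<dots> = d ^ Suc k" using Suc by (simp add: card_image inj_on_def)
  finally show ?case .
qed (simp add: pts_0)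

end

locale odd_words = words +
  assumes odd_d: "odd d" and H_alt: "H \<subseteq> carrier (alt_group d)"
begin

text \<open>Sorting by initial letter gives \<open>d\<close> blocks of odd size. Within a block the
  common initial letter is irrelevant and the induction hypothesis applies; between blocks only the
  inversions of \<open>s\<close> on the letters count, and \<open>s\<close> is even.\<close>

lemma even_letter_inversions:
  assumes "s \<in> H"
  shows "even (card (inversions wless ((\<circ>) s) (pts d k)))"
proof (induction k)
  case 0
  have e: "inversions wless ((\<circ>) s) (pts d 0) = {}"
    using wless_asym by (auto simp: inversions_def pts_0)
  show ?case unfolding e by simp
next
  case (Suc k)
  let ?R = "\<lambda>x y. wless x y \<and> wless (s \<circ> y) (s \<circ> x)"
  have perm: "s permutes {1..d}" "evenperm s" using assms H_alt alt_group_carrier by blast+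
  have "even (card {(x, y). x \<in> (\<Union>a\<in>{1..d}. conc [a] ` pts d k) \<and> y \<in> (\<Union>a\<in>{1..d}. conc [a] ` pts d k) \<and> ?R x y})
      \<longleftrightarrow> even (card {(a, b). a \<in> {1..d} \<and> b \<in> {1..d} \<and> a < b \<and> s b < s a})"
  proof (rule even_card_blocks)
    fix a assume "a \<in> {1..d}"
    show "odd (card (conc [a] ` pts d k))" using odd_d by (simp add: card_image inj_on_def card_pts)
    have "{(x, y). x \<in> conc [a] ` pts d k \<and> y \<in> conc [a] ` pts d k \<and> ?R x y}
        = (\<lambda>(x, y). (conc [a] x, conc [a] y)) ` inversions wless ((\<circ>) s) (pts d k)"
      by (auto simp: inversions_def conc_map)
    also have "card \<dots> = card (inversions wless ((\<circ>) s) (pts d k))"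
      by (rule card_image) (auto simp: inj_on_def)
    finally show "even (card {(x, y). x \<in> conc [a] ` pts d k \<and> y \<in> conc [a] ` pts d k \<and> ?R x y})"
      using Suc by simp
  next
    fix a b x y assume ab: "a \<in> {1..d}" "b \<in> {1..d}" "a \<noteq> b" "x \<in> conc [a] ` pts d k" "y \<in> conc [b] ` pts d k"
    have "s a \<noteq> s b" using ab(3) permutes_inj[OF perm(1)] by (simp add: inj_eq)
    moreover have "x 0 = a" "y 0 = b" using ab by (auto simp: conc_def)
    ultimately show "?R x y \<longleftrightarrow> a < b \<and> s b < s a"
      using ab(3) wless_first[of 0 x y] wless_first[of 0 "s \<circ> y" "s \<circ> x"] by auto
  qed (use conc_Cons_disjoint in auto)
  also have "{(a, b). a \<in> {1..d} \<and> b \<in> {1..d} \<and> a < b \<and> s b < s a} = inversions (<) s {1..d}"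
    by (auto simp: inversions_def)
  also have "even (card (inversions (<) s {1..d}))"
    using evenperm_iff_inversions[OF perm(1)] perm(2) by simp
  finally show ?case by (simp add: inversions_def pts_Suc)
qed

end

section \<open>Partitions into good cylinders and compactness\<close>

context words
begin

text \<open>The index set is left free, as the pieces will be the words of a level, the images of
  such words under another map, or the rows of a table.\<close>

definition good_partition :: "((nat \<Rightarrow> nat) \<Rightarrow> nat \<Rightarrow> nat) \<Rightarrow> 'i set \<Rightarrow> ('i \<Rightarrow> nat list) \<Rightarrow> bool" where
  "good_partition g I W \<longleftrightarrow> finite I \<and> (\<forall>i\<in>I. W i \<in> fwords d \<and> good d H g (W i)) \<and>
    (\<forall>i\<in>I. \<forall>j\<in>I. i \<noteq> j \<longrightarrow> cyl d (W i) \<inter> cyl d (W j) = {}) \<and> (\<Union>i\<in>I. cyl d (W i)) = iwords d"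

definition level :: "nat \<Rightarrow> nat list set" where
  "level N = {w \<in> fwords d. length w = N}"

lemma finite_level: "finite (level N)"
  unfolding level_def fwords_def using finite_lists_length_eq[of "{1..d}" N] by simp

lemma cyl_level_disjoint: "u \<in> level N \<Longrightarrow> v \<in> level N \<Longrightarrow> u \<noteq> v \<Longrightarrow> cyl d u \<inter> cyl d v = {}"
  by (auto simp: level_def mem_cyl_iff)

lemma cyl_level_cover: "(\<Union>w\<in>level N. cyl d w) = iwords d"
proof (intro equalityI subsetI)
  fix x assume "x \<in> iwords d"
  then show "x \<in> (\<Union>w\<in>level N. cyl d w)" by (intro UN_I[of "pre x N"]) (auto simp: level_def)
qed (auto simp: mem_cyl_iff)

lemma good_partition_level:
  "(\<And>w. w \<in> level N \<Longrightarrow> good d H g w) \<Longrightarrow> good_partition g (level N) (\<lambda>w. w)"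
  using cyl_level_disjoint cyl_level_cover finite_level
  by (auto simp: good_partition_def level_def)

text \<open>Compactness of the space of infinite words, in the form of Koenig's lemma.\<close>

lemma uniform_level:
  assumes her: "\<And>w a. P w \<Longrightarrow> w \<in> fwords d \<Longrightarrow> a \<in> {1..d} \<Longrightarrow> P (w @ [a])"
    and loc: "\<And>x. x \<in> iwords d \<Longrightarrow> \<exists>n. P (pre x n)"
  obtains N where "\<And>w. w \<in> level N \<Longrightarrow> P w"
proof (rule ccontr)
  assume "\<not> thesis"
  then have no: "\<exists>w\<in>level N. \<not> P w" for N using that by blast
  have her': "P (w @ v)" if "P w" "w \<in> fwords d" "v \<in> fwords d" for w v
    using that(3)
  proof (induction v rule: rev_induct)
    case (snoc a v)
    then show ?case using her[of "w @ v" a] that by simp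
  qed (use that in simp)
  define bad where "bad w \<longleftrightarrow> (\<forall>N. \<exists>v\<in>level N. \<not> P (w @ v))" for w
  have step: "\<exists>a\<in>{1..d}. bad (w @ [a])" if w: "bad w" "w \<in> fwords d" for w
  proof (rule ccontr)
    assume "\<not> ?thesis"
    then have "\<forall>a\<in>{1..d}. \<exists>N. \<forall>v\<in>level N. P ((w @ [a]) @ v)" unfolding bad_def by blast
    then obtain N where N: "\<And>a v. a \<in> {1..d} \<Longrightarrow> v \<in> level (N a) \<Longrightarrow> P ((w @ [a]) @ v)"
      using bchoice[of "{1..d}" "\<lambda>a n. \<forall>v\<in>level n. P ((w @ [a]) @ v)"] by blast
    \<comment> \<open>Heredity lifts the depths found below the individual letters to their maximum,
      so \<open>Suc M\<close> would be a uniform depth for \<open>w\<close> itself.\<close>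
    define M where "M = Max (N ` {1..d})"
    have M: "N a \<le> M" if "a \<in> {1..d}" for a using that by (auto simp: M_def)
    obtain v where v: "v \<in> level (Suc M)" "\<not> P (w @ v)" using w(1) unfolding bad_def by blast
    then obtain a v' where av: "v = a # v'" "a \<in> {1..d}" "v' \<in> fwords d" "length v' = M"
      unfolding level_def by (cases v) auto
    have tk: "take (N a) v' \<in> fwords d" "drop (N a) v' \<in> fwords d"
      using av(3) append_take_drop_id[of "N a" v'] by (metis fwords_append)+
    have "P ((w @ [a]) @ take (N a) v')" using N[OF av(2)] tk M[OF av(2)] av(4) by (simp add: level_def)
    moreover have "(w @ [a]) @ take (N a) v' \<in> fwords d" using tk w(2) av(2) by simp
    ultimately have "P (((w @ [a]) @ take (N a) v') @ drop (N a) v')"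
      using her' tk(2) by blast
    moreover have "((w @ [a]) @ take (N a) v') @ drop (N a) v' = w @ v" by (simp add: av(1))
    ultimately show False using v(2) by simp
  qed
  define nxt where "nxt w = (SOME a. a \<in> {1..d} \<and> bad (w @ [a]))" for w
  have nxt: "nxt w \<in> {1..d}" "bad (w @ [nxt w])" if "bad w" "w \<in> fwords d" for w
    using someI_ex[of "\<lambda>a. a \<in> {1..d} \<and> bad (w @ [a])"] step[OF that] unfolding nxt_def by blast+
  define W where "W = rec_nat [] (\<lambda>_ w. w @ [nxt w])"
  have W: "W 0 = []" "W (Suc n) = W n @ [nxt (W n)]" for n by (simp_all add: W_def)
  have "bad []" using no by (simp add: bad_def)
  then have Wb: "bad (W n) \<and> W n \<in> fwords d" for n
  proof (induction n)
    case (Suc n)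
    then show ?case using nxt[of "W n"] by (simp add: W)
  qed (simp add: W)
  define x where "x n = nxt (W n)" for n
  have "x \<in> iwords d" using Wb nxt by (simp add: iwords_def x_def)
  then obtain n where "P (pre x n)" using loc by blast
  moreover have "pre x n = W n" for n
    by (induction n) (simp_all add: W x_def pre_def)
  ultimately have "P (W n)" by simp
  moreover have "\<exists>v\<in>level 0. \<not> P (W n @ v)" using Wb by (simp add: bad_def)
  ultimately show False by (simp add: level_def)
qed

end

section \<open>The parity homomorphism\<close>

context odd_words
begin

text \<open>The blocks are the sample points in the individual cylinders. Inside a block
  \<open>g\<close> preserves and reverses the same pairs as an element of \<open>H\<close>; between
  blocks the order depends only on the cylinders and their images, so the representatives
  \<open>p i\<close> are arbitrary.\<close>

lemma even_inversions_pts: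
  assumes g: "bij g" and I: "good_partition g I W" and p: "\<And>i. i \<in> I \<Longrightarrow> p i \<in> cyl d (W i)"
    and N: "\<And>i. i \<in> I \<Longrightarrow> length (W i) \<le> N"
  shows "even (card (inversions wless g (pts d N))) \<longleftrightarrow>
    even (card {(i, j). i \<in> I \<and> j \<in> I \<and> wless (p i) (p j) \<and> wless (g (p j)) (g (p i))})"
proof -
  let ?R = "\<lambda>x y. wless x y \<and> wless (g y) (g x)"
  let ?B = "\<lambda>i. pts d N \<inter> cyl d (W i)"
  have IW: "finite I" "\<And>i. i \<in> I \<Longrightarrow> W i \<in> fwords d" "\<And>i. i \<in> I \<Longrightarrow> good d H g (W i)"
    "\<And>i j. i \<in> I \<Longrightarrow> j \<in> I \<Longrightarrow> i \<noteq> j \<Longrightarrow> cyl d (W i) \<inter> cyl d (W j) = {}"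
    "(\<Union>i\<in>I. cyl d (W i)) = iwords d"
    using I by (auto simp: good_partition_def)
  have "pts d N = (\<Union>i\<in>I. ?B i)" using IW(5) by (auto simp: pts_def)
  then have e1: "inversions wless g (pts d N) =
      {(x, y). x \<in> (\<Union>i\<in>I. ?B i) \<and> y \<in> (\<Union>i\<in>I. ?B i) \<and> ?R x y}"
    by (simp add: inversions_def)
  show ?thesis
    unfolding e1
  proof (rule even_card_blocks)
    fix i assume i: "i \<in> I"
    have B: "?B i = conc (W i) ` pts d (N - length (W i))"
      using pts_Int_cyl IW(2) N i by simp
    show "odd (card (?B i))" unfolding B using odd_d by (simp add: card_image inj_on_def card_pts)
    obtain u s where u: "s \<in> H" "acts d g (W i) u s" using IW(3)[OF i] by (auto simp: good_def)
    have gc: "g (conc (W i) y) = conc u (s \<circ> y)" if "y \<in> pts d (N - length (W i))" for y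
      using u(2) that by (simp add: acts_def pts_def)
    have "{(x, y). x \<in> ?B i \<and> y \<in> ?B i \<and> ?R x y} =
        (\<lambda>(x, y). (conc (W i) x, conc (W i) y)) ` inversions wless ((\<circ>) s) (pts d (N - length (W i)))"
      unfolding B by (auto simp: inversions_def gc)
    also have "card \<dots> = card (inversions wless ((\<circ>) s) (pts d (N - length (W i))))"
      by (rule card_image) (auto simp: inj_on_def)
    finally show "even (card {(x, y). x \<in> ?B i \<and> y \<in> ?B i \<and> ?R x y})"
      by (rule ssubst) (rule even_letter_inversions[OF u(1)])
    show "\<not> ?R (p i) (p i)" using wless_asym by blast
  next
    fix i j x y assume ij: "i \<in> I" "j \<in> I" "i \<noteq> j" and xy: "x \<in> ?B i" "y \<in> ?B j"
    note disj = IW(4)[OF ij]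
    obtain u where u: "g ` cyl d (W i) = cyl d u" using good_cyl[OF IW(3,2)[OF ij(1)]] by metis
    obtain v where v: "g ` cyl d (W j) = cyl d v" using good_cyl[OF IW(3,2)[OF ij(2)]] by metis
    have "cyl d v \<inter> cyl d u = {}"
      unfolding u[symmetric] v[symmetric] using disj bij_is_inj[OF g] by (auto dest: injD)
    then have "wless (g y) (g x) \<longleftrightarrow> wless (g (p j)) (g (p i))"
      by (rule wless_cyl_cong) (use xy p ij u v in blast)+
    moreover have "wless x y \<longleftrightarrow> wless (p i) (p j)"
      using disj by (rule wless_cyl_cong) (use xy p ij in blast)+
    ultimately show "?R x y \<longleftrightarrow> ?R (p i) (p j)" by blast
  next
    fix i j assume "i \<in> I" "j \<in> I" "i \<noteq> j"
    then show "?B i \<inter> ?B j = {}" using IW(4) by blast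
  qed (simp_all add: IW(1))
qed

text \<open>Tables are avoided altogether. The existential quantifier is harmless, because
  \<open>par_iff\<close> gives every admissible \<open>N\<close> the same parity.\<close>

definition par :: "((nat \<Rightarrow> nat) \<Rightarrow> nat \<Rightarrow> nat) \<Rightarrow> bool" where
  "par g \<longleftrightarrow> (\<exists>N. (\<forall>w\<in>level N. good d H g w) \<and> even (card (inversions wless g (pts d N))))"

text \<open>The count for the level \<open>N\<close> and the count for the given partition both
  agree modulo 2 with the count on a sample \<open>pts d M\<close> deep enough for both.\<close>

lemma par_iff:
  assumes g: "g \<in> Vd d H" and I: "good_partition g I W" and p: "\<And>i. i \<in> I \<Longrightarrow> p i \<in> cyl d (W i)"
  shows "par g \<longleftrightarrow> even (card {(i, j). i \<in> I \<and> j \<in> I \<and> wless (p i) (p j) \<and> wless (g (p j)) (g (p i))})"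
proof -
  have bg: "bij g" using VdD g by blast
  have eq: "even (card (inversions wless g (pts d N))) \<longleftrightarrow>
      even (card {(i, j). i \<in> I \<and> j \<in> I \<and> wless (p i) (p j) \<and> wless (g (p j)) (g (p i))})"
    if N: "\<forall>w\<in>level N. good d H g w" for N
  proof -
    define M where "M = Max (insert N (length ` W ` I))"
    have fin: "finite (insert N (length ` W ` I))" using I by (simp add: good_partition_def)
    have M: "N \<le> M" "\<And>i. i \<in> I \<Longrightarrow> length (W i) \<le> M"
      unfolding M_def by (rule Max_ge[OF fin]; blast)+
    let ?p = "\<lambda>w. conc w (\<lambda>_. 1)"
    have pts: "pts d N = ?p ` level N"
    proof (intro equalityI subsetI)
      fix x assume x: "x \<in> pts d N"
      then have "x = ?p (pre x N)" by (auto simp: pts_def conc_def fun_eq_iff)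
      moreover have "pre x N \<in> level N" using x by (auto simp: level_def pts_def)
      ultimately show "x \<in> ?p ` level N" by blast
    next
      fix x assume "x \<in> ?p ` level N"
      then obtain w where w: "w \<in> fwords d" "length w = N" "x = ?p w" by (auto simp: level_def)
      then have "x \<in> iwords d" by simp
      moreover have "x i = 1" if "i \<ge> N" for i using w that by (simp add: conc_def)
      ultimately show "x \<in> pts d N" by (simp add: pts_def)
    qed
    have inj: "inj_on ?p (level N)" by (auto simp: inj_on_def level_def conc_eq_append_iff)
    have e1: "inversions wless g (pts d N) = (\<lambda>(u, v). (?p u, ?p v)) `
        {(u, v). u \<in> level N \<and> v \<in> level N \<and> wless (?p u) (?p v) \<and> wless (g (?p v)) (g (?p u))}"
      by (auto simp: inversions_def pts)
    have e2: "card (inversions wless g (pts d N)) =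
        card {(u, v). u \<in> level N \<and> v \<in> level N \<and> wless (?p u) (?p v) \<and> wless (g (?p v)) (g (?p u))}"
      unfolding e1 by (rule card_image) (use inj in \<open>auto simp: inj_on_def\<close>)
    have e3: "even (card {(u, v). u \<in> level N \<and> v \<in> level N \<and> wless (?p u) (?p v) \<and> wless (g (?p v)) (g (?p u))})
        \<longleftrightarrow> even (card (inversions wless g (pts d M)))"
      by (rule even_inversions_pts[symmetric, OF bg good_partition_level])
         (use N M(1) in \<open>auto simp: level_def\<close>)
    show ?thesis
      unfolding e2 e3 by (rule even_inversions_pts[OF bg I p M(2)])
  qed
  obtain N where "\<And>w. w \<in> level N \<Longrightarrow> good d H g w"
    using uniform_level[of "good d H g"] good_append VdD(3)[OF g]
    unfolding locally_good_def by (metis fwords_Cons fwords_Nil)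
  then show ?thesis using eq unfolding par_def by blast
qed

text \<open>At a level where \<open>g\<close> sends each cylinder onto a cylinder good for
  \<open>f\<close>, the images form a good partition for \<open>f\<close>. Representing its pieces
  by the images of the sample points under \<open>g\<close> turns all three parities into inversion
  counts related by \<open>even_card_inversions_comp\<close>.\<close>

lemma par_comp:
  assumes f: "f \<in> Vd d H" and g: "g \<in> Vd d H"
  shows "par (f \<circ> g) \<longleftrightarrow> (par f = par g)"
proof -
  define P where "P w \<longleftrightarrow> (\<exists>u\<in>fwords d. \<exists>s\<in>H. acts d g w u s \<and> good d H f u)" for w
  have "P (w @ [a])" if Pw: "P w" and a: "a \<in> {1..d}" for w a
  proof -
    obtain u s where u: "u \<in> fwords d" "s \<in> H" "acts d g w u s" "good d H f u"
      using Pw by (auto simp: P_def)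
    have v: "[a] \<in> fwords d" using a by simp
    show ?thesis
      unfolding P_def
    proof (intro bexI conjI)
      show "acts d g (w @ [a]) (u @ map s [a]) s" using acts_append u v by blast
      show "good d H f (u @ map s [a])" using good_append u v H_fwords by blast
      show "u @ map s [a] \<in> fwords d" using u v H_fwords fwords_append by blast
    qed (rule u)
  qed
  moreover have "\<exists>n. P (pre x n)" if "x \<in> iwords d" for x
    using locally_good_image[OF g f that] unfolding P_def by metis
  ultimately obtain N where N: "\<And>w. w \<in> level N \<Longrightarrow> P w"
    using uniform_level[of P] by metis
  have bij: "bij f" "bij g" using VdD f g by auto
  have fg: "f \<circ> g \<in> Vd d H" using f g perm_groupD(4)[OF perm_group_Vd] by blast
  let ?L = "level N" and ?p = "\<lambda>w. conc w (\<lambda>_. 1)"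
  have P': "good d H g w \<and> good d H (f \<circ> g) w \<and> (\<exists>u\<in>fwords d. good d H f u \<and> g ` cyl d w = cyl d u)"
    if w: "w \<in> ?L" for w
  proof -
    obtain u s where u: "u \<in> fwords d" "s \<in> H" "acts d g w u s" "good d H f u"
      using N[OF w] by (auto simp: P_def)
    obtain t r where t: "t \<in> fwords d" "r \<in> H" "acts d f u t r" using u by (auto simp: good_def)
    have gw: "good d H g w" using u by (auto simp: good_def)
    have "acts d (f \<circ> g) w t (r \<circ> s)" using u t by (simp add: acts_def o_assoc)
    then have "good d H (f \<circ> g) w" unfolding good_def using t u H_comp by blast
    moreover have wf: "w \<in> fwords d" using w by (simp add: level_def)
    have "g ` cyl d w = cyl d u" using acts_image[OF u(3) wf u(1,2)] .
    ultimately show ?thesis using gw u by blast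
  qed
  then have "\<forall>w\<in>?L. \<exists>u. u \<in> fwords d \<and> good d H f u \<and> g ` cyl d w = cyl d u" by blast
  then obtain U where U: "\<And>w. w \<in> ?L \<Longrightarrow> U w \<in> fwords d \<and> good d H f (U w) \<and> g ` cyl d w = cyl d (U w)"
    using bchoice[of ?L "\<lambda>w u. u \<in> fwords d \<and> good d H f u \<and> g ` cyl d w = cyl d u"] by blast
  have p: "?p w \<in> cyl d w" if "w \<in> ?L" for w using that by (simp add: level_def)
  have "good_partition f ?L U"
    unfolding good_partition_def
  proof (intro conjI ballI impI)
    fix w w' assume w: "w \<in> ?L" "w' \<in> ?L" "w \<noteq> w'"
    have "g ` cyl d w \<inter> g ` cyl d w' = g ` (cyl d w \<inter> cyl d w')"
      using bij_is_inj[OF bij(2)] by (simp add: image_Int)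
    then show "cyl d (U w) \<inter> cyl d (U w') = {}"
      using U w cyl_level_disjoint[OF w] by auto
  next
    have "(\<Union>w\<in>?L. cyl d (U w)) = g ` (\<Union>w\<in>?L. cyl d w)" by (simp add: image_UN U)
    then show "(\<Union>w\<in>?L. cyl d (U w)) = iwords d" using cyl_level_cover VdD(4)[OF g] by simp
  qed (use U finite_level in auto)
  moreover have gp: "g (?p w) \<in> cyl d (U w)" if "w \<in> ?L" for w using that U p by blast
  ultimately have 1: "par f \<longleftrightarrow> even (card {(u, v). u \<in> ?L \<and> v \<in> ?L \<and>
      wless (g (?p u)) (g (?p v)) \<and> wless (f (g (?p v))) (f (g (?p u)))})"
    by (rule par_iff[OF f])
  have 2: "par g \<longleftrightarrow> even (card {(u, v). u \<in> ?L \<and> v \<in> ?L \<and> wless (?p u) (?p v) \<and> wless (g (?p v)) (g (?p u))})"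
    using P' p by (intro par_iff[OF g good_partition_level]) auto
  have 3: "par (f \<circ> g) \<longleftrightarrow> even (card {(u, v). u \<in> ?L \<and> v \<in> ?L \<and> wless (?p u) (?p v) \<and>
      wless ((f \<circ> g) (?p v)) ((f \<circ> g) (?p u))})"
    using P' p by (intro par_iff[OF fg good_partition_level]) auto
  have inj: "inj_on ?p ?L" by (auto simp: inj_on_def level_def conc_eq_append_iff)
  have reindex: "card {(u, v). u \<in> ?L \<and> v \<in> ?L \<and> wless (q u) (q v) \<and> wless (h (q v)) (h (q u))} =
      card (inversions wless h (q ` ?L))" if q: "inj_on q ?L" for q h
  proof -
    have e: "inversions wless h (q ` ?L) = (\<lambda>(u, v). (q u, q v)) `
        {(u, v). u \<in> ?L \<and> v \<in> ?L \<and> wless (q u) (q v) \<and> wless (h (q v)) (h (q u))}"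
      by (auto simp: inversions_def)
    show ?thesis
      unfolding e by (rule card_image[symmetric]) (use q in \<open>auto simp: inj_on_def\<close>)
  qed
  have injg: "inj_on g S" "inj_on f S" for S using bij_is_inj bij inj_on_subset by blast+
  have inj2: "inj_on (\<lambda>w. g (?p w)) ?L" using comp_inj_on[OF inj injg(1)] by (simp add: comp_def)
  have im: "(\<lambda>w. g (?p w)) ` ?L = g ` ?p ` ?L" by auto
  show ?thesis
    unfolding 1 2 3 reindex[OF inj] reindex[OF inj2] im
    by (rule even_card_inversions_comp) (use wless_asym wless_total finite_level injg in auto)
qed

end

section \<open>Tables and their parity\<close>

context words
begin

lemma sorted_partition_wless:
  assumes part: "is_partition d ws" and sorted: "sorted_wrt lexless ws"
    and ij: "i < length ws" "j < length ws" "i \<noteq> j" and xy: "x \<in> cyl d (ws ! i)" "y \<in> cyl d (ws ! j)"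
  shows "wless x y \<longleftrightarrow> i < j"
proof -
  have disj: "cyl d (ws ! i) \<inter> cyl d (ws ! j) = {}" "cyl d (ws ! j) \<inter> cyl d (ws ! i) = {}"
    using part ij by (auto simp: is_partition_def)
  show ?thesis
  proof (cases "i < j")
    case True
    then have "lexless (ws ! i) (ws ! j)" using sorted ij by (simp add: sorted_wrt_nth_less)
    then show ?thesis using lexless_imp_wless disj(1) xy True by blast
  next
    case False
    then have "lexless (ws ! j) (ws ! i)" using sorted ij by (simp add: sorted_wrt_nth_less)
    then have "wless y x" using lexless_imp_wless disj(2) xy by blast
    then show ?thesis using wless_asym False by blast
  qed
qed

text \<open>Needed because \<open>Vd'\<close> asks for the existence of an even table. The rows are
  the words of one level; sorting these words and their images separately leaves only one choice for
  \<open>\<tau>\<close>.\<close>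

lemma ex_table:
  assumes g: "g \<in> Vd d H"
  obtains vs us hs \<tau> where "is_table d H g vs us hs \<tau>"
proof -
  obtain N where N: "\<And>w. w \<in> level N \<Longrightarrow> good d H g w"
    using uniform_level[of "good d H g"] good_append VdD(3)[OF g]
    unfolding locally_good_def by (metis fwords_Cons fwords_Nil)
  have "\<exists>us. fst us \<in> fwords d \<and> snd us \<in> H \<and> acts d g w (fst us) (snd us) \<and> g ` cyl d w = cyl d (fst us)"
    if w: "w \<in> level N" for w
  proof -
    have "w \<in> fwords d" using w by (simp add: level_def)
    then obtain u s where "u \<in> fwords d" "s \<in> H" "acts d g w u s" "g ` cyl d w = cyl d u"
      using good_cyl[OF N[OF w]] by blast
    then show ?thesis by (intro exI[of _ "(u, s)"]) simp
  qed
  then obtain us where us: "\<And>w. w \<in> level N \<Longrightarrow> fst (us w) \<in> fwords d \<and> snd (us w) \<in> H \<and>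
      acts d g w (fst (us w)) (snd (us w)) \<and> g ` cyl d w = cyl d (fst (us w))"
    by metis
  define U where "U w = fst (us w)" for w
  have U: "U w \<in> fwords d" "g ` cyl d w = cyl d (U w)" if "w \<in> level N" for w
    using us that by (auto simp: U_def)
  have inj_g: "inj g" using VdD g bij_is_inj by blast
  have disjU: "cyl d (U w) \<inter> cyl d (U w') = {}" if "w \<in> level N" "w' \<in> level N" "w \<noteq> w'" for w w'
  proof -
    have "g ` cyl d w \<inter> g ` cyl d w' = {}"
      using cyl_level_disjoint[OF that] inj_g by (auto dest: injD)
    then show ?thesis using U that by simp
  qed
  have injU: "inj_on U (level N)"
  proof (rule inj_onI, rule ccontr)
    fix w w' assume w: "w \<in> level N" "w' \<in> level N" "U w = U w'" "w \<noteq> w'"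
    then have "cyl d (U w) = {}" using disjU by force
    then show False using cyl_nonempty U w by blast
  qed
  define vs where "vs = sorted_list_of_set (level N)"
  define ts where "ts = sorted_list_of_set (U ` level N)"
  have vs: "set vs = level N" "distinct vs" and ts: "set ts = U ` level N" "distinct ts"
    using finite_level by (simp_all add: vs_def ts_def)
  have len: "length vs = card (level N)" "length ts = card (level N)"
    using finite_level injU by (simp_all add: vs_def ts_def card_image)
  have sorted: "sorted_wrt lexless vs" "sorted_wrt lexless ts"
    unfolding vs_def ts_def lexless_def list_less_def[symmetric]
    using strict_sorted_list_of_set by blast+
  define m where "m = length vs"
  have bv: "bij_betw ((!) vs) {..<m} (level N)"
    using bij_betw_nth[OF vs(2)] vs(1) by (simp add: m_def)
  have bt: "bij_betw ((!) ts) {..<m} (U ` level N)"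
    using bij_betw_nth[OF ts(2)] ts(1) len by (simp add: m_def)
  \<comment> \<open>The position of the image word of row \<open>i\<close> in the sorted list of
    images; \<open>permutes\<close> requires the identity from \<open>m\<close> on.\<close>
  define \<tau> where "\<tau> i = (if i < m then inv_into {..<m} ((!) ts) (U (vs ! i)) else i)" for i
  have b: "bij_betw (inv_into {..<m} ((!) ts) \<circ> (U \<circ> (!) vs)) {..<m} {..<m}"
    using bij_betw_trans[OF bij_betw_trans[OF bv inj_on_imp_bij_betw[OF injU]] bij_betw_inv_into[OF bt]] .
  have "\<tau> i = (inv_into {..<m} ((!) ts) \<circ> (U \<circ> (!) vs)) i" if "i \<in> {..<m}" for i
    using that by (simp add: \<tau>_def)
  then have "bij_betw \<tau> {..<m} {..<m}" using b by (simp only: bij_betw_cong[of "{..<m}" \<tau>])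
  then have perm: "\<tau> permutes {..<m}" by (rule bij_imp_permutes) (simp add: \<tau>_def)
  have vsl: "vs ! i \<in> level N" if "i < m" for i
    using that nth_mem[of i vs] unfolding vs(1) m_def by blast
  have ts_tau: "ts ! \<tau> i = U (vs ! i)" if "i < m" for i
  proof -
    have "U (vs ! i) \<in> (!) ts ` {..<m}" using bt vsl[OF that] by (simp add: bij_betw_def)
    then show ?thesis using that f_inv_into_f by (simp add: \<tau>_def)
  qed
  have "is_partition d vs"
    unfolding is_partition_def
  proof (intro conjI allI impI)
    show "set vs \<subseteq> fwords d" using vs(1) by (auto simp: level_def)
    show "(\<Union>i<length vs. cyl d (vs ! i)) = iwords d"
      using bv cyl_level_cover[of N] by (simp add: bij_betw_def m_def image_image flip: UN_simps(10))
    fix i j assume "i < length vs" "j < length vs" "i \<noteq> j"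
    then show "cyl d (vs ! i) \<inter> cyl d (vs ! j) = {}"
      using vs(2) by (intro cyl_level_disjoint[OF vsl vsl]) (simp_all add: m_def nth_eq_iff_index_eq)
  qed
  moreover have "is_partition d ts"
    unfolding is_partition_def
  proof (intro conjI allI impI)
    show "set ts \<subseteq> fwords d" using ts(1) U by auto
    have "(\<Union>i<length ts. cyl d (ts ! i)) = (\<Union>u\<in>U ` level N. cyl d u)"
      using bt len by (simp add: bij_betw_def m_def flip: UN_simps(10))
    also have "\<dots> = g ` (\<Union>w\<in>level N. cyl d w)" using U by (simp add: image_UN)
    finally show "(\<Union>i<length ts. cyl d (ts ! i)) = iwords d"
      using cyl_level_cover VdD(4)[OF g] by simp
    fix i j assume ij: "i < length ts" "j < length ts" "i \<noteq> j"
    then obtain w w' where "w \<in> level N" "w' \<in> level N" "ts ! i = U w" "ts ! j = U w'"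
      using ts(1) by (metis imageE nth_mem)
    then show "cyl d (ts ! i) \<inter> cyl d (ts ! j) = {}"
      using disjU ij ts(2) by (metis nth_eq_iff_index_eq)
  qed
  ultimately have "is_table d H g vs ts (\<lambda>i. snd (us (vs ! i))) \<tau>"
    using sorted perm len us vsl ts_tau
    by (auto simp: is_table_def acts_def U_def m_def)
  then show ?thesis by (rule that)
qed

end

context odd_words
begin

text \<open>With one point chosen in each row, the pairs reversed by \<open>g\<close> are exactly
  the inversions of \<open>\<tau>\<close>, as both lists of words are sorted.\<close>

lemma par_iff_evenperm:
  assumes g: "g \<in> Vd d H" and t: "is_table d H g vs us hs \<tau>"
  shows "par g \<longleftrightarrow> evenperm \<tau>"
proof -
  let ?I = "{..<length vs}" and ?p = "\<lambda>i. conc (vs ! i) (\<lambda>_. 1)"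
  have tab: "length vs = length us" "sorted_wrt lexless vs" "sorted_wrt lexless us"
    "is_partition d vs" "is_partition d us" "\<And>i. i < length vs \<Longrightarrow> hs i \<in> H" "\<tau> permutes ?I"
    "\<And>i. i < length vs \<Longrightarrow> acts d g (vs ! i) (us ! \<tau> i) (hs i)"
    using t by (auto simp: is_table_def acts_def)
  have vs: "vs ! i \<in> fwords d" if "i < length vs" for i
    using tab(4) that by (auto simp: is_partition_def)
  have \<tau>: "\<tau> i < length us" if "i < length vs" for i
    using permutes_in_image[OF tab(7), of i] that tab(1) by simp
  have us: "us ! \<tau> i \<in> fwords d" if "i < length vs" for i
    using tab(5) \<tau>[OF that] by (auto simp: is_partition_def)
  have "good_partition g ?I ((!) vs)"
    unfolding good_partition_def
  proof (intro conjI ballI impI)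
    fix i assume i: "i \<in> ?I"
    then show "vs ! i \<in> fwords d" using vs by simp
    show "good d H g (vs ! i)" unfolding good_def using us tab(6,8) i by blast
  qed (use tab(4) in \<open>auto simp: is_partition_def\<close>)
  moreover have p: "?p i \<in> cyl d (vs ! i)" if "i \<in> ?I" for i using that vs by simp
  ultimately have 1: "par g \<longleftrightarrow> even (card {(i, j). i \<in> ?I \<and> j \<in> ?I \<and> wless (?p i) (?p j) \<and> wless (g (?p j)) (g (?p i))})"
    by (rule par_iff[OF g])
  have gp: "g (?p i) \<in> cyl d (us ! \<tau> i)" if "i < length vs" for i
    using tab(8)[OF that] us[OF that] tab(6)[OF that] const_mem by (simp add: acts_def)
  have "wless (?p i) (?p j) \<and> wless (g (?p j)) (g (?p i)) \<longleftrightarrow> i < j \<and> \<tau> j < \<tau> i"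
    if ij: "i \<in> ?I" "j \<in> ?I" for i j
  proof (cases "i = j")
    case True
    then show ?thesis using wless_asym by blast
  next
    case False
    then have "\<tau> j \<noteq> \<tau> i" using permutes_inj[OF tab(7)] by (simp add: inj_eq)
    then have "wless (g (?p j)) (g (?p i)) \<longleftrightarrow> \<tau> j < \<tau> i"
      using sorted_partition_wless[OF tab(5,3) \<tau> \<tau>] gp ij by simp
    moreover have "wless (?p i) (?p j) \<longleftrightarrow> i < j"
      using sorted_partition_wless[OF tab(4,2) _ _ False p[OF ij(1)] p[OF ij(2)]] ij by simp
    ultimately show ?thesis by blast
  qed
  then have 2: "{(i, j). i \<in> ?I \<and> j \<in> ?I \<and> wless (?p i) (?p j) \<and> wless (g (?p j)) (g (?p i))} = inversions (<) \<tau> ?I"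
    unfolding inversions_def by blast
  show ?thesis unfolding 1 2 using evenperm_iff_inversions[OF tab(7)] by simp
qed

lemma Vd'_eq: "Vd' d H = {g \<in> Vd d H. par g}"
proof -
  have "(\<exists>vs us hs \<tau>. is_table d H g vs us hs \<tau> \<and> evenperm \<tau>) \<longleftrightarrow> par g" if "g \<in> Vd d H" for g
    using par_iff_evenperm[OF that] ex_table[OF that] by metis
  then show ?thesis using odd_d H_alt unfolding Vd'_def by (simp cong: conj_cong)
qed

lemma par_id: "par id"
proof -
  have "par (id \<circ> id) \<longleftrightarrow> (par id = par id)"
    using par_comp perm_groupD(1)[OF perm_group_Vd] by blast
  then show ?thesis by simp
qed

lemma par_inv:
  assumes "g \<in> Vd d H"
  shows "par (inv g) = par g"
proof -
  have "g \<circ> inv g = id" using VdD(1)[OF assms] by (simp add: fun_eq_iff)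
  then show ?thesis
    using par_comp[OF assms perm_groupD(3)[OF perm_group_Vd assms]] par_id by simp
qed

lemma perm_group_par: "perm_group {g \<in> Vd d H. par g}"
  using perm_groupD[OF perm_group_Vd] par_id par_inv par_comp by (simp add: perm_group_def)

text \<open>Each of \<open>f\<close> and \<open>g\<close> occurs together with its inverse, of equal
  parity, so the parities cancel.\<close>

lemma comms_par: "comms (Vd d H) \<subseteq> {g \<in> Vd d H. par g}"
proof
  fix x assume "x \<in> comms (Vd d H)"
  then obtain f g where fg: "f \<in> Vd d H" "g \<in> Vd d H" "x = f \<circ> g \<circ> inv f \<circ> inv g"
    by (auto simp: comms_def comm_def)
  then show "x \<in> {g \<in> Vd d H. par g}"
    using perm_groupD(3,4)[OF perm_group_Vd] by (auto simp: par_comp par_inv)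
qed

end

text \<open>These three facts are all that the simplicity argument has to know about
  \<open>Vd'\<close>; they unify the two cases of its definition.\<close>

lemma (in words) Vd'_between: "perm_group (Vd' d H)" "Vd' d H \<subseteq> Vd d H" "comms (Vd d H) \<subseteq> Vd' d H"
proof -
  consider "odd d" "H \<subseteq> carrier (alt_group d)" | "Vd' d H = Vd d H" by (metis Vd'_def)
  then have "perm_group (Vd' d H) \<and> Vd' d H \<subseteq> Vd d H \<and> comms (Vd d H) \<subseteq> Vd' d H"
  proof cases
    case 1
    then interpret odd_words d H by (intro odd_words.intro words_axioms odd_words_axioms.intro)
    show ?thesis unfolding Vd'_eq using perm_group_par comms_par by blast
  next
    case 2
    then show ?thesis using perm_group_Vd comm_in[OF perm_group_Vd] by (auto simp: comms_def)
  qed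
  then show "perm_group (Vd' d H)" "Vd' d H \<subseteq> Vd d H" "comms (Vd d H) \<subseteq> Vd' d H" by blast+
qed

section \<open>Simplicity of the commutator subgroup\<close>

text \<open>The shape of \<open>Vgrp'\<close> for an arbitrary set of functions, so that restricting
  the carrier to a subgroup yields a group of the same form.\<close>

definition fun_grp :: "('a \<Rightarrow> 'a) set \<Rightarrow> ('a \<Rightarrow> 'a) monoid" where
  "fun_grp S = \<lparr>carrier = S, monoid.mult = (\<circ>), one = id\<rparr>"

lemma fun_grp_simps [simp]:
  "carrier (fun_grp S) = S" "f \<otimes>\<^bsub>fun_grp S\<^esub> g = f \<circ> g" "\<one>\<^bsub>fun_grp S\<^esub> = id"
  "(fun_grp S)\<lparr>carrier := T\<rparr> = fun_grp T"
  by (simp_all add: fun_grp_def)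

lemma group_fun_grp:
  assumes "perm_group S"
  shows "group (fun_grp S)"
proof (rule groupI)
  fix f assume f: "f \<in> carrier (fun_grp S)"
  then have "inv f \<circ> f = id" using perm_groupD(2)[OF assms, of f] by (simp add: fun_eq_iff)
  then show "\<exists>g\<in>carrier (fun_grp S). g \<otimes>\<^bsub>fun_grp S\<^esub> f = \<one>\<^bsub>fun_grp S\<^esub>"
    using perm_groupD(3)[OF assms, of f] f by auto
qed (use perm_groupD[OF assms] in \<open>auto simp: o_assoc\<close>)

lemma m_inv_fun_grp:
  assumes "perm_group S" "f \<in> S"
  shows "m_inv (fun_grp S) f = inv f"
proof (rule group.inv_equality[OF group_fun_grp[OF assms(1)]])
  show "inv f \<otimes>\<^bsub>fun_grp S\<^esub> f = \<one>\<^bsub>fun_grp S\<^esub>"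
    using perm_groupD(2)[OF assms] by (simp add: fun_eq_iff)
qed (use perm_groupD(3)[OF assms] assms(2) in auto)

lemma subgroup_fun_grp_iff:
  assumes "perm_group S"
  shows "subgroup K (fun_grp S) \<longleftrightarrow> K \<subseteq> S \<and> perm_group K"
proof
  assume K: "subgroup K (fun_grp S)"
  have sub: "K \<subseteq> S" using subgroup.subset[OF K] by simp
  have "inv f \<in> K" if "f \<in> K" for f
    using subgroup.m_inv_closed[OF K that] m_inv_fun_grp[OF assms, of f] that sub by auto
  then show "K \<subseteq> S \<and> perm_group K"
    using sub subgroup.m_closed[OF K] subgroup.one_closed[OF K] perm_groupD(2)[OF assms]
    by (auto simp: perm_group_def)
next
  assume K: "K \<subseteq> S \<and> perm_group K"
  then show "subgroup K (fun_grp S)"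
    using perm_groupD[of K] m_inv_fun_grp[OF assms]
    by (intro subgroup.intro) (auto simp: subset_iff)
qed

theorem theorem8p16:
  fixes d :: nat and H :: "(nat \<Rightarrow> nat) set"
  assumes "d \<ge> 2" and "subgroup H (sym_group d)"
  shows "simple_grp ((Vgrp' d H)\<lparr>carrier := derived (Vgrp' d H) (carrier (Vgrp' d H))\<rparr>)"
proof -
  interpret words d H using assms by (rule words.intro)
  interpret ball_group "iwords d" "cyl d ` fwords d" "Vd d H" by (rule ball_group_Vd)
  define G where "G = Vd' d H"
  define D where "D = derived (fun_grp G) G"
  have G: "perm_group G" "G \<subseteq> Vd d H" "comms (Vd d H) \<subseteq> G"
    using Vd'_between by (simp_all add: G_def)
  interpret G: group "fun_grp G" using group_fun_grp[OF G(1)] .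
  have "derived_set (fun_grp G) G = comms G"
    using m_inv_fun_grp[OF G(1)] by (auto simp: comms_def comm_def)
  then have D_gen: "D = generate (fun_grp G) (comms G)" by (simp add: D_def derived_def)
  have cG: "comms G \<subseteq> carrier (fun_grp G)" using comm_in[OF G(1)] by (auto simp: comms_def)
  have DG: "subgroup D (fun_grp G)" unfolding D_gen by (rule G.generate_is_subgroup[OF cG])
  then have D: "D \<subseteq> G" "perm_group D" using subgroup_fun_grp_iff[OF G(1)] by auto
  have cD: "comms G \<subseteq> D" unfolding D_gen by (auto intro: generate.incl)
  have min: "D \<subseteq> K" if K: "perm_group K" "comms G \<subseteq> K" for K
  proof -
    \<comment> \<open>Generation takes place inside \<open>fun_grp G\<close>, while \<open>K\<close>
      is not assumed to be contained in \<open>G\<close>.\<close>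
    have "perm_group (K \<inter> G)" using K(1) G(1) by (auto simp: perm_group_def)
    then have "subgroup (K \<inter> G) (fun_grp G)" using subgroup_fun_grp_iff[OF G(1)] by blast
    then have "D \<subseteq> K \<inter> G"
      unfolding D_gen using K(2) cG by (intro G.generate_subgroup_incl) auto
    then show ?thesis by blast
  qed
  have "simple_grp (fun_grp D)"
    unfolding simple_grp_def
  proof (intro conjI allI impI)
    show "group (fun_grp D)" using group_fun_grp[OF D(2)] .
    show "carrier (fun_grp D) \<noteq> {\<one>\<^bsub>fun_grp D\<^esub>}"
      using D_nontrivial[OF G D(2) cD min] by simp
    fix N assume N: "N \<lhd> fun_grp D"
    have "subgroup N (fun_grp D)" using N by (rule normal_imp_subgroup)
    then have N': "N \<subseteq> D" "perm_group N" using subgroup_fun_grp_iff[OF D(2)] by auto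
    have conj: "g \<circ> x \<circ> inv g \<in> N" if "g \<in> D" "x \<in> N" for g x
      using normal.inv_op_closed2[OF N, of g x] that m_inv_fun_grp[OF D(2)] by simp
    show "N = {\<one>\<^bsub>fun_grp D\<^esub>} \<or> N = carrier (fun_grp D)"
      using D_subset_N[OF G D(2) cD min N'(2,1) conj] N'(1) by auto
  qed
  moreover have "Vgrp' d H = fun_grp G" by (simp add: Vgrp'_def fun_grp_def G_def)
  ultimately show ?thesis by (simp add: D_def)
qed

end
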